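(* Let $\alpha>0$ and for holomorphic $g(z)=\sum_{k\ge0}\hat g(k)z^k$ on the unit disk let $\sigma_n^\alpha(g):=\sum_{k=0}^n\binom{n}{k}\big/\binom{n+\alpha}{k}\,\hat g(k)z^k$. Then: (1) $\|\sigma_n^\alpha(g)-g\|_{A^1}\to0$ for all $g\in A^1$; (2) $\sigma_n^\alpha(h)\to h$ weak* in $\mathcal B$ for all $h\in\mathcal B$; (3) $\|\sigma_n^\alpha(f)-f\|_{\mathcal B}\to0$ for all $f\in\mathcal B_0$.
   Context: Binomial coefficients with non-integer arguments are defined via the Gamma function. $A^1$ is the Bergman space of holomorphic $f$ on the unit disk $\mathbb D$ with $\|f\|_{A^1}=\frac1\pi\int_{\mathbb D}|f|\,dA<\infty$. $\mathcal B$ is the Bloch space with norm $|f(0)|+\sup_{\mathbb D}(1-|z|^2)|f'(z)|$ and $\mathcal B_0$ the closed subspace where $(1-|z|^2)|f'(z)|\to0$ as $|z|\to1$. $\mathcal B$ is identified (up to isomorphism) with $(A^1)^*$ via $\langle g,h\rangle=\lim_{r\to1^-}\frac1\pi\int_{|z|<r}g(z)h(\overline z)\,dA(z)$; weak* refers to this duality. *)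

theory Defs
  imports "HOL-Complex_Analysis.Complex_Analysis"
begin

definition taylor_coeff :: "(complex \<Rightarrow> complex) \<Rightarrow> nat \<Rightarrow> complex" where
  "taylor_coeff g k = (deriv ^^ k) g 0 / of_nat (fact k)"

text \<open>The Cesaro-type means sigma_n^alpha; binomials with non-integer upper
  argument via gchoose (agrees with the Gamma-function definition).\<close>
definition sigma_mean :: "real \<Rightarrow> nat \<Rightarrow> (complex \<Rightarrow> complex) \<Rightarrow> complex \<Rightarrow> complex" where
  "sigma_mean \<alpha> n g z =
     (\<Sum>k = 0..n. of_real (real (n choose k) / ((real n + \<alpha>) gchoose k))
                   * taylor_coeff g k * z ^ k)"

definition bergman_norm :: "(complex \<Rightarrow> complex) \<Rightarrow> real" where
  "bergman_norm f = (1 / pi) * (LINT z : ball 0 1 | lborel. cmod (f z))"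

definition bergman_A1 :: "(complex \<Rightarrow> complex) set" where
  "bergman_A1 = {f. f holomorphic_on ball 0 1 \<and>
                    set_integrable lborel (ball 0 1) (\<lambda>z. cmod (f z))}"

definition bloch_space :: "(complex \<Rightarrow> complex) set" where
  "bloch_space = {f. f holomorphic_on ball 0 1 \<and>
                     bdd_above ((\<lambda>z. (1 - (cmod z)\<^sup>2) * cmod (deriv f z)) ` ball 0 1)}"

definition bloch_norm :: "(complex \<Rightarrow> complex) \<Rightarrow> real" where
  "bloch_norm f = cmod (f 0) + (SUP z \<in> ball 0 1. (1 - (cmod z)\<^sup>2) * cmod (deriv f z))"

definition little_bloch :: "(complex \<Rightarrow> complex) set" where
  "little_bloch = {f. f \<in> bloch_space \<and>
      (\<forall>\<epsilon>>0. \<exists>r<1. \<forall>z. r < cmod z \<and> cmod z < 1 \<longrightarrow>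
                 (1 - (cmod z)\<^sup>2) * cmod (deriv f z) < \<epsilon>)}"

definition bergman_pairing :: "(complex \<Rightarrow> complex) \<Rightarrow> (complex \<Rightarrow> complex) \<Rightarrow> complex" where
  "bergman_pairing g h =
     Lim (at_left 1) (\<lambda>r::real. of_real (1 / pi) *
        (LINT z : ball 0 r | lborel. g z * h (cnj z)))"

end

theory Submission
  imports Defs "HOL-Real_Asymp.Real_Asymp"
begin

text \<open>The factors of \<open>sigma_mean \<alpha> n\<close> are the Cesaro weights \<open>A (n - k) / A n\<close> of order \<open>\<alpha>\<close>, where
  \<open>A m = (\<Prod>j=1..m. 1 + \<alpha> / j)\<close>. On power series they act as convolution with any kernel that has these
  Fourier coefficients at the indices \<open>k \<ge> 0\<close>; the coefficients at negative indices can be chosen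
  freely. Continuing \<open>A\<close> beyond \<open>n\<close> with a linear cut-off and decomposing dyadically around the
  singularity at \<open>k = n\<close> gives kernels that are bounded in \<open>L\<^sup>1\<close> for every \<open>\<alpha> > 0\<close>. By rotation
  invariance, the means then do not increase integrals or suprema over annuli \<open>s \<le> \<bar>z\<bar> < 1\<close> by more
  than a constant factor, so the convergence in the two norms follows from uniform convergence on
  compact sets. For the pairing, \<open>\<langle>g, h\<rangle>\<close> is rewritten as the absolutely convergent integral of
  \<open>(1 - \<bar>z\<bar>\<^sup>2) * g z * (2 * h + id * h') (cnj z)\<close>, which is bounded by the norm of \<open>g\<close>; moreover
  \<open>\<langle>g, \<sigma> h\<rangle> = \<langle>\<sigma> g, h\<rangle>\<close>.\<close>

section \<open>Rotation invariance of planar Lebesgue measure\<close>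

text \<open>The obstacle is small \<open>\<alpha>\<close>. Near \<open>k = n\<close> the weights
  behave like \<open>(1 - k / n) ^ \<alpha>\<close>, so for \<open>\<alpha> < 1\<close> their
  increments are not of order \<open>1 / n\<close>, and no single smoothness estimate gives an
  \<open>L1\<close> bound uniform in \<open>n\<close>. At distance \<open>m = n - k\<close> from
  that index, however, the weights have size \<open>A m / A n\<close> and increments of relative
  size \<open>1 / m\<close>. A piece with \<open>m\<close> of order \<open>N\<close> is thus as good
  as a smooth bump of height \<open>A N / A n\<close>, and these heights are summable over dyadic
  \<open>N\<close> because \<open>A\<close> grows at least by a fixed factor under doubling. The
  freedom at negative \<open>k\<close> is essential: a sharp cut-off below \<open>k = 0\<close>
  would leave a jump there and a logarithmic growth of the norm, as for the Dirichlet kernel. The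
  detour through the weight \<open>1 - |z|^2\<close> answers another difficulty: a Bloch function
  may grow logarithmically at the boundary, so \<open>g z * h (cnj z)\<close> need not be integrable
  over the disk and the limit defining the pairing is not an instance of dominated
  convergence.\<close>

lemma measurable_complex_of_pair [measurable]:
  "(\<lambda>p. Complex (fst p) (snd p)) \<in> borel_measurable (lborel \<Otimes>\<^sub>M lborel)"
proof -
  have "(\<lambda>p. of_real (fst p) + \<i> * of_real (snd p)) \<in> borel_measurable (lborel \<Otimes>\<^sub>M lborel)"
    by measurable
  then show ?thesis by (simp add: Complex_eq)
qed

text \<open>Both measures give a box the product of its two side lengths, and this determines
  Lebesgue measure. The identity makes Tonelli's theorem available for planar integrals.\<close>

lemma lborel_complex_eq:
  "(lborel :: complex measure) = distr (lborel \<Otimes>\<^sub>M lborel) borel (\<lambda>p. Complex (fst p) (snd p))"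
proof (rule lborel_eqI)
  fix l u :: complex
  assume le: "\<And>b. b \<in> Basis \<Longrightarrow> l \<bullet> b \<le> u \<bullet> b"
  have le': "Re l \<le> Re u" "Im l \<le> Im u"
    using le[of 1] le[of \<i>] by (auto simp: Basis_complex_def)
  have vim: "(\<lambda>p. Complex (fst p) (snd p)) -` box l u \<inter> space (lborel \<Otimes>\<^sub>M lborel)
      = {Re l<..<Re u} \<times> {Im l<..<Im u}"
    by (auto simp: box_def Basis_complex_def space_pair_measure)
  have "emeasure (distr (lborel \<Otimes>\<^sub>M lborel) borel (\<lambda>p. Complex (fst p) (snd p))) (box l u)
      = emeasure (lborel \<Otimes>\<^sub>M lborel) ({Re l<..<Re u} \<times> {Im l<..<Im u})"
    by (subst emeasure_distr) (simp_all add: vim)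
  also have "\<dots> = ennreal (Re u - Re l) * ennreal (Im u - Im l)"
    using le' by (subst lborel.emeasure_pair_measure_Times) auto
  also have "\<dots> = ennreal ((Re u - Re l) * (Im u - Im l))"
    using le' by (simp add: ennreal_mult)
  also have "(Re u - Re l) * (Im u - Im l) = (\<Prod>b\<in>Basis. (u - l) \<bullet> b)"
    by (simp add: Basis_complex_def)
  finally show "emeasure (distr (lborel \<Otimes>\<^sub>M lborel) borel (\<lambda>p. Complex (fst p) (snd p))) (box l u)
      = (\<Prod>b\<in>Basis. (u - l) \<bullet> b)" .
qed simp

lemma nn_integral_complex_iterated:
  fixes f :: "complex \<Rightarrow> ennreal"
  assumes [measurable]: "f \<in> borel_measurable borel"
  shows "(\<integral>\<^sup>+z. f z \<partial>lborel) = (\<integral>\<^sup>+x. \<integral>\<^sup>+y. f (Complex x y) \<partial>lborel \<partial>lborel)"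
    and "(\<integral>\<^sup>+z. f z \<partial>lborel) = (\<integral>\<^sup>+y. \<integral>\<^sup>+x. f (Complex x y) \<partial>lborel \<partial>lborel)"
proof -
  have eq: "(\<integral>\<^sup>+z. f z \<partial>lborel) = (\<integral>\<^sup>+p. f (Complex (fst p) (snd p)) \<partial>(lborel \<Otimes>\<^sub>M lborel))"
    by (subst lborel_complex_eq, subst nn_integral_distr) auto
  have m: "(\<lambda>p. f (Complex (fst p) (snd p))) \<in> borel_measurable (lborel \<Otimes>\<^sub>M lborel)"
    by measurable
  show "(\<integral>\<^sup>+z. f z \<partial>lborel) = (\<integral>\<^sup>+x. \<integral>\<^sup>+y. f (Complex x y) \<partial>lborel \<partial>lborel)"
    using lborel.nn_integral_fst[OF m] eq by simp
  show "(\<integral>\<^sup>+z. f z \<partial>lborel) = (\<integral>\<^sup>+y. \<integral>\<^sup>+x. f (Complex x y) \<partial>lborel \<partial>lborel)"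
    using lborel_pair.nn_integral_snd[OF m] eq by simp
qed

text \<open>If the inner integral runs in the direction of the shear, then the shear acts there as a
  translation whose amount depends on the outer variable only.\<close>

lemma nn_integral_shear:
  fixes f :: "complex \<Rightarrow> ennreal" and t :: real
  assumes [measurable]: "f \<in> borel_measurable borel"
  shows "(\<integral>\<^sup>+z. f (z + of_real (t * Im z)) \<partial>lborel) = (\<integral>\<^sup>+z. f z \<partial>lborel)"
    and "(\<integral>\<^sup>+z. f (z + \<i> * of_real (t * Re z)) \<partial>lborel) = (\<integral>\<^sup>+z. f z \<partial>lborel)"
proof -
  have [measurable]: "(\<lambda>x. Complex x y) \<in> borel_measurable borel"
    "(\<lambda>y. Complex x y) \<in> borel_measurable borel" for x y
    unfolding Complex_eq by measurable
  have 1: "Complex x y + of_real (t * y) = Complex (t * y + 1 * x) y" for x y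
    by (simp add: complex_eq_iff)
  have 2: "Complex x y + \<i> * of_real (t * x) = Complex x (t * x + 1 * y)" for x y
    by (simp add: complex_eq_iff)
  have trans_x: "(\<integral>\<^sup>+x. f (Complex (s + 1 * x) y) \<partial>lborel) = (\<integral>\<^sup>+x. f (Complex x y) \<partial>lborel)" for s y
    using nn_integral_real_affine[of "\<lambda>x. f (Complex x y)" 1 s] by simp
  have trans_y: "(\<integral>\<^sup>+y. f (Complex x (s + 1 * y)) \<partial>lborel) = (\<integral>\<^sup>+y. f (Complex x y) \<partial>lborel)" for s x
    using nn_integral_real_affine[of "\<lambda>y. f (Complex x y)" 1 s] by simp
  have "(\<integral>\<^sup>+z. f (z + of_real (t * Im z)) \<partial>lborel) =
      (\<integral>\<^sup>+y. \<integral>\<^sup>+x. f (Complex (t * y + 1 * x) y) \<partial>lborel \<partial>lborel)"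
    by (subst nn_integral_complex_iterated(2)) (measurable, simp only: complex.sel 1)
  also have "\<dots> = (\<integral>\<^sup>+y. \<integral>\<^sup>+x. f (Complex x y) \<partial>lborel \<partial>lborel)"
    by (intro nn_integral_cong trans_x)
  finally show "(\<integral>\<^sup>+z. f (z + of_real (t * Im z)) \<partial>lborel) = (\<integral>\<^sup>+z. f z \<partial>lborel)"
    by (simp add: nn_integral_complex_iterated(2)[symmetric])
  have "(\<integral>\<^sup>+z. f (z + \<i> * of_real (t * Re z)) \<partial>lborel) =
      (\<integral>\<^sup>+x. \<integral>\<^sup>+y. f (Complex x (t * x + 1 * y)) \<partial>lborel \<partial>lborel)"
    by (subst nn_integral_complex_iterated(1)) (measurable, simp only: complex.sel 2)
  also have "\<dots> = (\<integral>\<^sup>+x. \<integral>\<^sup>+y. f (Complex x y) \<partial>lborel \<partial>lborel)"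
    by (intro nn_integral_cong trans_y)
  finally show "(\<integral>\<^sup>+z. f (z + \<i> * of_real (t * Re z)) \<partial>lborel) = (\<integral>\<^sup>+z. f z \<partial>lborel)"
    by (simp add: nn_integral_complex_iterated(1)[symmetric])
qed

lemma nn_integral_lborel_rotate:
  fixes f :: "complex \<Rightarrow> ennreal" and c :: complex
  assumes [measurable]: "f \<in> borel_measurable borel" and c: "norm c = 1"
  shows "(\<integral>\<^sup>+z. f (c * z) \<partial>lborel) = (\<integral>\<^sup>+z. f z \<partial>lborel)"
proof -
  text \<open>A rotation by an angle other than \<open>\<pi>\<close> is a product of three shears.\<close>
  have *: "(\<integral>\<^sup>+z. f (c * z) \<partial>lborel) = (\<integral>\<^sup>+z. f z \<partial>lborel)"
    if c: "norm c = 1" "c \<noteq> -1" and [measurable]: "f \<in> borel_measurable borel"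
    for c :: complex and f :: "complex \<Rightarrow> ennreal"
  proof -
    \<comment> \<open>For \<open>c = cis \<theta>\<close> these are \<open>cos \<theta>\<close>,
      \<open>sin \<theta>\<close> and \<open>- tan (\<theta> / 2)\<close>. The half-angle tangent is
      what excludes \<open>c = -1\<close>, which is handled below as two quarter turns.\<close>
    define x y t where "x = Re c" and "y = Im c" and "t = - y / (1 + x)"
    have xy: "x\<^sup>2 + y\<^sup>2 = 1" using c(1) by (simp add: x_def y_def cmod_def)
    have x1: "1 + x \<noteq> 0"
    proof
      assume "1 + x = 0"
      then have "x = -1" by simp
      moreover from this xy have "y = 0" by simp
      ultimately show False using c(2) by (simp add: x_def y_def complex_eq_iff)
    qed
    have x2: "1 + t * y = x" using x1 xy by (simp add: t_def field_simps power2_eq_square)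
    have x3: "t + (t + t * y * t) = - y"
    proof -
      have "t + (t + t * y * t) = t * (1 + (1 + t * y))" by (simp add: algebra_simps)
      also have "\<dots> = - y" unfolding x2 using x1 by (simp add: t_def)
      finally show ?thesis .
    qed
    define S where "S u = u + of_real (t * Im u)" for u :: complex
    define R where "R u = u + \<i> * of_real (y * Re u)" for u :: complex
    have [measurable]: "S \<in> borel_measurable borel" "R \<in> borel_measurable borel"
      unfolding S_def[abs_def] R_def[abs_def] by measurable
    have "c * z = S (R (S z))" for z
    proof (rule complex_eqI)
      have "Re (S (R (S z))) = Re z * (1 + t * y) + Im z * (t + (t + t * y * t))"
        by (simp add: S_def R_def algebra_simps)
      then show "Re (c * z) = Re (S (R (S z)))"
        unfolding x2 x3 by (simp add: x_def y_def algebra_simps)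
      have "Im (S (R (S z))) = Re z * y + Im z * (1 + t * y)"
        by (simp add: S_def R_def algebra_simps)
      then show "Im (c * z) = Im (S (R (S z)))"
        unfolding x2 by (simp add: x_def y_def algebra_simps)
    qed
    then have "(\<integral>\<^sup>+z. f (c * z) \<partial>lborel) = (\<integral>\<^sup>+z. f (S (R (S z))) \<partial>lborel)" by simp
    also have "\<dots> = (\<integral>\<^sup>+z. f (S (R z)) \<partial>lborel)"
      unfolding S_def[of "_ :: complex"]
      using nn_integral_shear(1)[of "\<lambda>z. f (S (R z))" t] by (simp add: S_def)
    also have "\<dots> = (\<integral>\<^sup>+z. f (S z) \<partial>lborel)"
      using nn_integral_shear(2)[of "\<lambda>z. f (S z)" y] by (simp add: R_def)
    also have "\<dots> = (\<integral>\<^sup>+z. f z \<partial>lborel)"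
      using nn_integral_shear(1)[of f t] by (simp add: S_def)
    finally show ?thesis .
  qed
  show ?thesis
  proof (cases "c = -1")
    case True
    have "(\<integral>\<^sup>+z. f (c * z) \<partial>lborel) = (\<integral>\<^sup>+z. f (\<i> * (\<i> * z)) \<partial>lborel)"
      using True by (simp add: mult.assoc[symmetric])
    also have "\<dots> = (\<integral>\<^sup>+z. f (\<i> * z) \<partial>lborel)"
      by (subst *[of \<i> "\<lambda>z. f (\<i> * z)"]) (auto simp: complex_eq_iff)
    also have "\<dots> = (\<integral>\<^sup>+z. f z \<partial>lborel)"
      by (subst *[of \<i>]) (auto simp: complex_eq_iff)
    finally show ?thesis .
  qed (use * c assms(1) in auto)
qed

lemma distr_lborel_rotate:
  fixes c :: complex
  assumes "norm c = 1"
  shows "distr lborel borel ((*) c) = lborel"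
proof (rule measure_eqI)
  fix A assume "A \<in> sets (distr lborel borel ((*) c))"
  then have [measurable]: "A \<in> sets borel" by simp
  have "emeasure (distr lborel borel ((*) c)) A = (\<integral>\<^sup>+z. indicator A z \<partial>distr lborel borel ((*) c))"
    by simp
  also have "\<dots> = (\<integral>\<^sup>+z. indicator A (c * z) \<partial>lborel)"
    by (rule nn_integral_distr) auto
  also have "\<dots> = emeasure lborel A"
    by (subst nn_integral_lborel_rotate) (use assms in auto)
  finally show "emeasure (distr lborel borel ((*) c)) A = emeasure lborel A" .
qed simp

lemma integral_lborel_rotate:
  fixes f :: "complex \<Rightarrow> 'a::{banach,second_countable_topology}"
  assumes "f \<in> borel_measurable borel" "norm c = 1"
  shows "(\<integral>z. f (c * z) \<partial>lborel) = (\<integral>z. f z \<partial>lborel)"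
  using integral_distr[of "(*) c" lborel borel f] assms by (simp add: distr_lborel_rotate)

section \<open>Trigonometric polynomials in L1\<close>

lemma integrable_Icc_continuous:
  fixes f :: "real \<Rightarrow> 'a::{banach,second_countable_topology}"
  assumes "continuous_on {a..b} f"
  shows "integrable (restrict_space lborel {a..b}) f"
  using borel_integrable_atLeastAtMost'[OF assms]
  by (simp add: integrable_restrict_space set_integrable_def)

lemma integral_Icc_eq_integral:
  fixes f :: "real \<Rightarrow> 'a::euclidean_space"
  assumes "continuous_on {a..b} f"
  shows "(\<integral>t. f t \<partial>restrict_space lborel {a..b}) = integral {a..b} f"
  using set_borel_integral_eq_integral(2)[OF borel_integrable_atLeastAtMost'[OF assms]]
  by (simp add: integral_restrict_space set_lebesgue_integral_def)

text \<open>The circle with total mass 1. The interval is centred so that \<open>|t|\<close> is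
  comparable with the distance of \<open>ee t\<close> from 1, the point where the kernels
  concentrate.\<close>

definition circ :: "real measure" where
  "circ = restrict_space lborel {-(1/2)..1/2}"

definition ee :: "real \<Rightarrow> complex" where
  "ee t = cis (2 * pi * t)"

lemma space_circ [simp]: "space circ = {-(1/2)..1/2}"
  by (simp add: circ_def space_restrict_space)

lemma measure_circ [simp]: "measure circ {-(1/2)..1/2} = 1"
  by (simp add: circ_def measure_restrict_space)

interpretation circ: finite_measure circ
  by (rule finite_measureI) (simp add: circ_def emeasure_restrict_space space_restrict_space)

lemma integrable_circ:
  fixes f :: "real \<Rightarrow> 'a::{banach,second_countable_topology}"
  assumes "continuous_on UNIV f"
  shows "integrable circ f"
  unfolding circ_def by (rule integrable_Icc_continuous) (rule continuous_on_subset[OF assms], simp)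

lemma norm_ee [simp]: "norm (ee t) = 1"
  by (simp add: ee_def)

lemma continuous_on_ee [continuous_intros]:
  assumes "continuous_on A f"
  shows "continuous_on A (\<lambda>x. ee (f x))"
  unfolding ee_def by (intro continuous_intros assms)

lemma ee_add: "ee (s + t) = ee s * ee t"
  by (simp add: ee_def cis_mult distrib_left)

lemma ee_minus: "ee (- t) = cnj (ee t)"
  by (simp add: ee_def cis_cnj)

lemma ee_of_nat_mult: "ee (of_nat k * t) = ee t ^ k"
  by (simp add: ee_def Complex.DeMoivre mult_ac)

lemma integral_ee:
  fixes k :: int
  shows "(\<integral>t. ee (of_int k * t) \<partial>circ) = (if k = 0 then 1 else 0)"
proof (cases "k = 0")
  case True
  then show ?thesis by (simp add: ee_def)
next
  case False
  define c where "c = 2 * pi * of_int k"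
  have c: "c \<noteq> 0" using False by (simp add: c_def)
  have "((\<lambda>t. ee (of_int k * t)) has_integral
      ((- \<i> / of_real c) * cis (c * (1/2)) - (- \<i> / of_real c) * cis (c * -(1/2)))) {-(1/2)..1/2}"
  proof (rule fundamental_theorem_of_calculus)
    fix t :: real
    have "((\<lambda>w. - \<i> / of_real c * exp (\<i> * (of_real c * w))) has_field_derivative exp (\<i> * (of_real c * of_real t)))
        (at (of_real t))"
      using c by (auto intro!: derivative_eq_intros)
    from has_vector_derivative_real_field[OF this]
    show "((\<lambda>t. - \<i> / of_real c * cis (c * t)) has_vector_derivative ee (of_int k * t))
        (at t within {-(1/2)..1/2})"
      by (simp add: ee_def c_def cis_conv_exp mult_ac)
  qed simp
  moreover have "cis (c * (1/2)) = cis (c * -(1/2))"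
  proof -
    have "cis (c * (1/2)) = cis (c * -(1/2)) * cis c"
      by (simp add: cis_mult)
    also have "cis c = 1"
      using cis_multiple_2pi[of "of_int k"] by (simp add: c_def)
    finally show ?thesis by simp
  qed
  ultimately have "integral {-(1/2)..1/2} (\<lambda>t. ee (of_int k * t)) = 0"
    by (simp add: has_integral_iff)
  then show ?thesis
    unfolding circ_def using False by (subst integral_Icc_eq_integral) (auto intro!: continuous_intros)
qed

lemma integral_ee_mult_cnj:
  "(\<integral>t. ee t ^ j * cnj (ee t ^ k) \<partial>circ) = (if j = k then 1 else 0)"
proof -
  have "ee t ^ j * cnj (ee t ^ k) = ee (of_int (int j - int k) * t)" for t
    by (simp add: ee_of_nat_mult[symmetric] ee_minus[symmetric] ee_add[symmetric] algebra_simps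
             flip: complex_cnj_power)
  then have "(\<integral>t. ee t ^ j * cnj (ee t ^ k) \<partial>circ) = (\<integral>t. ee (of_int (int j - int k) * t) \<partial>circ)"
    by (simp only:)
  also have "\<dots> = (if j = k then 1 else 0)"
    by (subst integral_ee) simp
  finally show ?thesis .
qed

lemma parseval_trig_poly:
  fixes u :: "nat \<Rightarrow> real"
  shows "(\<integral>t. (norm (\<Sum>m\<in>A. of_real (u m) * ee t ^ m))\<^sup>2 \<partial>circ) = (\<Sum>m\<in>A. (u m)\<^sup>2)"
proof -
  define P where "P t = (\<Sum>m\<in>A. of_real (u m) * ee t ^ m)" for t
  have cP: "continuous_on UNIV P"
    unfolding P_def by (intro continuous_intros)
  have "complex_of_real (\<integral>t. (norm (P t))\<^sup>2 \<partial>circ) = (\<integral>t. complex_of_real ((norm (P t))\<^sup>2) \<partial>circ)"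
    by (simp del: of_real_power)
  also have "\<dots> = (\<integral>t. P t * cnj (P t) \<partial>circ)"
    by (intro Bochner_Integration.integral_cong refl) (simp add: complex_norm_square del: of_real_power)
  also have "\<dots> = (\<integral>t. (\<Sum>m\<in>A. \<Sum>k\<in>A. of_real (u m * u k) * (ee t ^ m * cnj (ee t ^ k))) \<partial>circ)"
    by (intro Bochner_Integration.integral_cong refl)
      (simp add: P_def sum_product algebra_simps)
  also have "\<dots> = (\<Sum>m\<in>A. \<Sum>k\<in>A. of_real (u m * u k) * (\<integral>t. ee t ^ m * cnj (ee t ^ k) \<partial>circ))"
    by (subst Bochner_Integration.integral_sum, (intro integrable_circ continuous_intros)[1],
        intro sum.cong refl, subst Bochner_Integration.integral_sum,
        (intro integrable_circ continuous_intros)[1], intro sum.cong refl integral_mult_right_zero)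
  also have "\<dots> = of_real (\<Sum>m\<in>A. (u m)\<^sup>2)"
  proof (cases "finite A")
    case True
    then show ?thesis
      unfolding integral_ee_mult_cnj
      by (simp add: if_distrib[of "\<lambda>x. _ * x"] power2_eq_square cong: if_cong)
  qed simp
  finally show ?thesis
    by (simp only: of_real_eq_iff P_def)
qed

text \<open>The chord has length \<open>2 * sin (pi * |t|)\<close>. The crude bound
  \<open>x / 2 \<le> sin x\<close> is enough, since \<open>pi \<ge> 2\<close> makes up for the lost
  factor.\<close>

lemma norm_one_minus_ee:
  assumes "\<bar>t\<bar> \<le> 1/2"
  shows "2 * \<bar>t\<bar> \<le> norm (1 - ee t)"
proof -
  \<comment> \<open>Up to \<open>pi / 3\<close> the cosine is at least \<open>1 / 2\<close> and
    \<open>x * cos x \<le> sin x\<close>. Beyond that point the sine is at least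
    \<open>sqrt 3 / 2\<close>, which exceeds \<open>pi / 4\<close>.\<close>
  have sin: "x / 2 \<le> sin x" if "0 \<le> x" "x \<le> pi / 2" for x
  proof (cases "x \<le> pi / 3")
    case True
    have "x * (1/2) \<le> x * cos x"
      using True that cos_monotone_0_pi_le[of x "pi/3"] by (intro mult_left_mono) (auto simp: cos_60)
    also have "\<dots> \<le> sin x"
    proof -
      have "sin 0 - 0 * cos 0 \<le> sin x - x * cos x"
        by (rule DERIV_nonneg_imp_nondecreasing[OF that(1)])
          (use that in \<open>auto intro!: exI derivative_eq_intros simp: sin_ge_zero\<close>)
      then show ?thesis by simp
    qed
    finally show ?thesis by simp
  next
    case False
    have "x / 2 \<le> pi / 4" using that by simp
    also have "\<dots> \<le> sqrt 3 / 2"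
    proof -
      have "1.7 \<le> sqrt (3::real)" by (rule real_le_rsqrt) (simp add: power2_eq_square)
      with pi_less_4 pi_approx show ?thesis by simp
    qed
    also have "\<dots> = sin (pi / 3)" by (simp add: sin_60)
    also have "\<dots> \<le> sin x"
      using False that by (intro sin_monotone_2pi_le) auto
    finally show ?thesis .
  qed
  have "\<bar>t\<bar> \<le> pi * \<bar>t\<bar> / 2"
    using mult_right_mono[OF pi_ge_two, of "\<bar>t\<bar>"] by simp
  also have "\<dots> \<le> sin (pi * \<bar>t\<bar>)"
    using assms by (intro sin) auto
  finally have 1: "\<bar>t\<bar> \<le> sin (pi * \<bar>t\<bar>)" .
  have "(norm (1 - ee t))\<^sup>2 = (1 - cos (2 * pi * t))\<^sup>2 + (sin (2 * pi * t))\<^sup>2"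
    by (simp add: cmod_def ee_def)
  also have "\<dots> = 2 - 2 * cos (2 * (pi * t))"
    using sin_cos_squared_add[of "2 * (pi * t)"] by (simp add: power2_eq_square algebra_simps)
  also have "\<dots> = (2 * sin (pi * t))\<^sup>2"
    unfolding cos_double_sin by (simp add: power2_eq_square)
  also have "\<dots> = (2 * sin (pi * \<bar>t\<bar>))\<^sup>2"
    by (cases "t \<ge> 0") auto
  finally have "norm (1 - ee t) = 2 * sin (pi * \<bar>t\<bar>)"
    using 1 by (smt (verit) norm_ge_zero power2_eq_imp_eq)
  then show ?thesis using 1 by simp
qed

text \<open>The integrand is concentrated on \<open>|t|\<close> of order \<open>1 / n\<close>. The
  chord estimate replaces it by a function with primitive
  \<open>arctan (2 * n * t) / (2 * n)\<close>, whose integral is \<open>arctan n / n\<close>; the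
  constant 2 then comes from \<open>pi < 4\<close>.\<close>

lemma integral_weight_le:
  assumes "n > 0"
  shows "(\<integral>t. 1 / (1 + (real n * norm (1 - ee t))\<^sup>2) \<partial>circ) \<le> 2 / real n"
proof -
  have pos: "1 + (real n * norm (1 - ee t))\<^sup>2 > 0" "1 + (2 * real n * t)\<^sup>2 > 0" for t
    by (intro add_pos_nonneg; simp)+
  have ne: "1 + (real n * norm (1 - ee t))\<^sup>2 \<noteq> 0" "1 + (2 * real n * t)\<^sup>2 \<noteq> 0" for t
    using pos[of t] by linarith+
  have "(\<integral>t. 1 / (1 + (real n * norm (1 - ee t))\<^sup>2) \<partial>circ) \<le> (\<integral>t. 1 / (1 + (2 * real n * t)\<^sup>2) \<partial>circ)"
  proof (rule integral_mono)
    fix t assume "t \<in> space circ"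
    then have "real n * (2 * \<bar>t\<bar>) \<le> real n * norm (1 - ee t)"
      by (intro mult_left_mono norm_one_minus_ee) auto
    then have "\<bar>2 * real n * t\<bar> \<le> \<bar>real n * norm (1 - ee t)\<bar>"
      by (simp add: abs_mult)
    then have "(2 * real n * t)\<^sup>2 \<le> (real n * norm (1 - ee t))\<^sup>2"
      by (simp only: abs_le_square_iff)
    then show "1 / (1 + (real n * norm (1 - ee t))\<^sup>2) \<le> 1 / (1 + (2 * real n * t)\<^sup>2)"
      using pos by (intro divide_left_mono mult_pos_pos) auto
  qed (intro integrable_circ continuous_intros ballI ne)+
  also have "\<dots> = integral {-(1/2)..1/2} (\<lambda>t. 1 / (1 + (2 * real n * t)\<^sup>2))"
    unfolding circ_def by (intro integral_Icc_eq_integral continuous_intros ballI ne)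
  also have "\<dots> = arctan (2 * real n * (1/2)) / (2 * real n) - arctan (2 * real n * -(1/2)) / (2 * real n)"
    by (intro integral_unique fundamental_theorem_of_calculus)
      (use assms ne in \<open>auto intro!: derivative_eq_intros simp flip: has_real_derivative_iff_has_vector_derivative
        simp: inverse_eq_divide\<close>)
  also have "\<dots> = arctan (real n) / real n"
    by (simp add: arctan_minus)
  also have "\<dots> \<le> 2 / real n"
    using arctan_ubound[of "real n"] pi_less_4 by (intro divide_right_mono) auto
  finally show ?thesis .
qed

text \<open>Carlson's inequality bounding the Wiener norm, with the Cauchy--Schwarz inequality replaced
  by \<open>2 \<bar>P\<bar> \<le> B n / W + W \<bar>P\<bar>\<^sup>2 / (B n)\<close> for the weight \<open>W = 1 + n\<^sup>2 \<bar>1 - e\<bar>\<^sup>2\<close>.\<close>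
lemma L1_norm_trig_poly_le:
  fixes u :: "nat \<Rightarrow> real"
  assumes n: "n > 0" and u0: "u 0 = 0" and uM: "u (2 * n) = 0" and B: "B > 0"
    and bd: "\<And>m. m \<le> 2 * n \<Longrightarrow> \<bar>u m\<bar> \<le> B"
    and bd': "\<And>m. m < 2 * n \<Longrightarrow> \<bar>u (Suc m) - u m\<bar> \<le> B / real n"
  shows "(\<integral>t. norm (\<Sum>m\<le>2*n. of_real (u m) * ee t ^ m) \<partial>circ) \<le> 3 * B"
proof -
  define P where "P t = (\<Sum>m\<le>2*n. of_real (u m) * ee t ^ m)" for t
  define Q where "Q t = (\<Sum>m\<in>{..<2*n}. of_real (u (Suc m) - u m) * ee t ^ m)" for t
  define W where "W t = 1 + (real n * norm (1 - ee t))\<^sup>2" for t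
  have Wpos: "W t > 0" for t by (simp add: W_def add_pos_nonneg)
  then have Wne: "W t \<noteq> 0" for t using less_irrefl by metis
  have cont: "continuous_on UNIV P" "continuous_on UNIV Q" "continuous_on UNIV W"
    unfolding P_def Q_def W_def by (intro continuous_intros)+
  \<comment> \<open>Summation by parts: multiplication by \<open>1 - ee t\<close> turns the
    coefficients into their differences. There are no boundary terms because \<open>u\<close>
    vanishes at 0 and at \<open>2 * n\<close>.\<close>
  have PQ: "(1 - ee t) * P t = ee t * Q t" for t
  proof -
    have 1: "P t = (\<Sum>m<2*n. of_real (u m) * ee t ^ m)"
      unfolding P_def using uM by (simp add: lessThan_Suc_atMost[symmetric])
    have 2: "P t = (\<Sum>m<2*n. of_real (u (Suc m)) * ee t ^ Suc m)"
      unfolding P_def using u0 by (simp add: sum.atMost_shift)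
    have "(1 - ee t) * P t = P t - ee t * P t" by (simp add: algebra_simps)
    also have "\<dots> = (\<Sum>m<2*n. of_real (u (Suc m)) * ee t ^ Suc m)
        - ee t * (\<Sum>m<2*n. of_real (u m) * ee t ^ m)"
      using 1 2 by metis
    also have "\<dots> = ee t * Q t"
      by (simp add: Q_def sum_distrib_left sum_subtractf algebra_simps)
    finally show ?thesis .
  qed
  have "norm (Q t) = norm (1 - ee t) * norm (P t)" for t
    using arg_cong[OF PQ[of t], of norm] by (simp add: norm_mult)
  then have WP: "W t * (norm (P t))\<^sup>2 = (norm (P t))\<^sup>2 + (real n)\<^sup>2 * (norm (Q t))\<^sup>2" for t
    by (simp add: W_def algebra_simps power2_eq_square)
  have intP: "integrable circ (\<lambda>t. (norm (P t))\<^sup>2)" and intQ: "integrable circ (\<lambda>t. (norm (Q t))\<^sup>2)"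
    by (intro integrable_circ continuous_intros cont)+
  have SP: "(\<Sum>m\<le>2*n. (u m)\<^sup>2) \<le> 2 * real n * B\<^sup>2"
  proof -
    have "(\<Sum>m\<le>2*n. (u m)\<^sup>2) = (\<Sum>m<2*n. (u m)\<^sup>2)"
      using uM by (simp add: lessThan_Suc_atMost[symmetric])
    also have "\<dots> \<le> (\<Sum>m<2*n. B\<^sup>2)"
    proof (rule sum_mono)
      fix m assume "m \<in> {..<2*n}"
      then have "\<bar>u m\<bar> \<le> \<bar>B\<bar>" using bd[of m] by auto
      then show "(u m)\<^sup>2 \<le> B\<^sup>2" by (simp only: abs_le_square_iff)
    qed
    finally show ?thesis by simp
  qed
  have SQ: "(\<Sum>m<2*n. (u (Suc m) - u m)\<^sup>2) \<le> 2 * real n * (B / real n)\<^sup>2"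
  proof -
    have "(\<Sum>m<2*n. (u (Suc m) - u m)\<^sup>2) \<le> (\<Sum>m<2*n. (B / real n)\<^sup>2)"
    proof (rule sum_mono)
      fix m assume "m \<in> {..<2*n}"
      then have "\<bar>u (Suc m) - u m\<bar> \<le> \<bar>B / real n\<bar>" using bd'[of m] B by auto
      then show "(u (Suc m) - u m)\<^sup>2 \<le> (B / real n)\<^sup>2" by (simp only: abs_le_square_iff)
    qed
    then show ?thesis by simp
  qed
  \<comment> \<open>By the previous identity the weighted square integral is a combination of those
    of \<open>P\<close> and \<open>Q\<close>, and Parseval evaluates both. The factor
    \<open>n^2\<close> in \<open>W\<close> balances the size \<open>B / n\<close> of the
    differences.\<close>
  have "(\<integral>t. W t * (norm (P t))\<^sup>2 \<partial>circ)
      = (\<Sum>m\<le>2*n. (u m)\<^sup>2) + (real n)\<^sup>2 * (\<Sum>m<2*n. (u (Suc m) - u m)\<^sup>2)"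
    unfolding WP Bochner_Integration.integral_add[OF intP integrable_mult_right[OF intQ]] integral_mult_right_zero
    unfolding P_def Q_def parseval_trig_poly by (rule refl)
  also have "\<dots> \<le> 2 * real n * B\<^sup>2 + (real n)\<^sup>2 * (2 * real n * (B / real n)\<^sup>2)"
    using SP SQ by (intro add_mono mult_left_mono) auto
  also have "\<dots> = 4 * real n * B\<^sup>2"
    using n by (simp add: field_simps power2_eq_square)
  finally have WP': "(\<integral>t. W t * (norm (P t))\<^sup>2 \<partial>circ) \<le> 4 * real n * B\<^sup>2" .
  have amgm: "norm (P t) \<le> (B * real n / 2) * (1 / W t) + (1 / (2 * (B * real n))) * (W t * (norm (P t))\<^sup>2)" for t
  proof -
    have "0 \<le> (B * real n - W t * norm (P t))\<^sup>2 / (2 * (B * real n) * W t)"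
      using Wpos[of t] B n by (intro divide_nonneg_nonneg) auto
    also have "\<dots> = (B * real n / 2) * (1 / W t) + (1 / (2 * (B * real n))) * (W t * (norm (P t))\<^sup>2) - norm (P t)"
      using Wpos[of t] B n by (simp add: field_simps power2_eq_square)
    finally show ?thesis by simp
  qed
  have "(\<integral>t. norm (P t) \<partial>circ) \<le> (\<integral>t. (B * real n / 2) * (1 / W t) + (1 / (2 * (B * real n))) * (W t * (norm (P t))\<^sup>2) \<partial>circ)"
    by (intro integral_mono amgm integrable_circ continuous_intros cont ballI Wne)
  also have "\<dots> = (B * real n / 2) * (\<integral>t. 1 / W t \<partial>circ) + (1 / (2 * (B * real n))) * (\<integral>t. W t * (norm (P t))\<^sup>2 \<partial>circ)"
    by (subst Bochner_Integration.integral_add)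
      ((intro integrable_circ continuous_intros cont ballI Wne)+, simp only: integral_mult_right_zero)
  \<comment> \<open>The first term contributes \<open>B\<close>, the second
    \<open>2 * B\<close>.\<close>
  also have "\<dots> \<le> (B * real n / 2) * (2 / real n) + (1 / (2 * (B * real n))) * (4 * real n * B\<^sup>2)"
    using B n WP' integral_weight_le[OF n] unfolding W_def by (intro add_mono mult_left_mono) auto
  also have "\<dots> = 3 * B"
    using B n by (simp add: field_simps power2_eq_square)
  finally show ?thesis by (simp add: P_def)
qed

section \<open>The Cesaro kernel\<close>

text \<open>This is the binomial coefficient of \<open>n + \<alpha>\<close> over \<open>n\<close>,
  that is, the coefficient of \<open>x ^ n\<close> in \<open>(1 - x) ^ (- \<alpha> - 1)\<close>. It
  is of order \<open>n ^ \<alpha>\<close>.\<close>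

definition cesaro_num :: "real \<Rightarrow> nat \<Rightarrow> real" where
  "cesaro_num \<alpha> n = (\<Prod>j=1..n. 1 + \<alpha> / real j)"

definition cesaro_weight :: "real \<Rightarrow> nat \<Rightarrow> nat \<Rightarrow> real" where
  "cesaro_weight \<alpha> n k = real (n choose k) / ((real n + \<alpha>) gchoose k)"

text \<open>The index \<open>m\<close> stands for \<open>n - k\<close>. The plateau
  \<open>m \<le> n\<close> covers the prescribed coefficients \<open>k \<ge> 0\<close>, and the
  slope lies in the free range \<open>k < 0\<close>. The order of the branches makes
  \<open>cutoff 0\<close> the indicator of 0, so there is no division by zero.\<close>

definition cutoff :: "nat \<Rightarrow> nat \<Rightarrow> real" where
  "cutoff n m = (if m \<le> n then 1 else if 2 * n \<le> m then 0 else 2 - real m / real n)"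

lemma cutoff_bounds: "0 \<le> cutoff n m" "cutoff n m \<le> 1"
  by (auto simp: cutoff_def field_simps)

text \<open>The maximum in the denominator accounts for \<open>n = 0\<close>, where the cut-off
  jumps from 1 to 0.\<close>

lemma cutoff_lipschitz: "\<bar>cutoff n (Suc m) - cutoff n m\<bar> \<le> 1 / max 1 (real n)"
proof (cases "n = 0")
  case True
  then show ?thesis by (simp add: cutoff_def)
next
  case False
  have *: "cutoff n m = max 0 (min 1 (2 - real m / real n))" for m
    using False by (auto simp: cutoff_def field_simps max_def min_def)
  have "real (Suc m) / real n = real m / real n + 1 / real n"
    by (simp add: add_divide_distrib)
  moreover have "1 / real n > 0" using False by simp
  moreover have "max 1 (real n) = real n" using False by simp
  ultimately show ?thesis
    unfolding * by linarith
qed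

context
  fixes \<alpha> :: real
  assumes \<alpha>: "\<alpha> > 0"
begin

section \<open>Growth of the Cesaro numbers\<close>

lemma cesaro_num_0 [simp]: "cesaro_num \<alpha> 0 = 1"
  by (simp add: cesaro_num_def)

lemma cesaro_num_Suc: "cesaro_num \<alpha> (Suc n) = cesaro_num \<alpha> n * (1 + \<alpha> / real (Suc n))"
  by (simp add: cesaro_num_def)

lemma cesaro_num_pos: "cesaro_num \<alpha> n > 0"
  unfolding cesaro_num_def using \<alpha> by (intro prod_pos) (auto intro!: add_pos_nonneg)

lemma cesaro_num_mono: "n \<le> m \<Longrightarrow> cesaro_num \<alpha> n \<le> cesaro_num \<alpha> m"
proof (induction m rule: dec_induct)
  case (step m)
  have "cesaro_num \<alpha> m * 1 \<le> cesaro_num \<alpha> (Suc m)"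
    unfolding cesaro_num_Suc using \<alpha> cesaro_num_pos[of m] by (intro mult_left_mono) auto
  with step show ?case by simp
qed simp

text \<open>Each of the \<open>m - n\<close> steps adds at least \<open>\<alpha> / M\<close> times
  the initial value. This linear bound replaces the true power growth; it suffices because it is
  used only between \<open>n div 2\<close> and \<open>n\<close>.\<close>

lemma cesaro_num_growth_lower:
  assumes "n \<le> m" "m \<le> M"
  shows "cesaro_num \<alpha> n * (1 + \<alpha> * real (m - n) / real M) \<le> cesaro_num \<alpha> m"
  using assms
proof (induction m rule: dec_induct)
  case (step m)
  have "real (Suc m - n) = real (m - n) + 1" using step.hyps by simp
  then have "cesaro_num \<alpha> n * (1 + \<alpha> * real (Suc m - n) / real M)
      = cesaro_num \<alpha> n * (1 + \<alpha> * real (m - n) / real M) + cesaro_num \<alpha> n * (\<alpha> / real M)"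
    by (simp add: algebra_simps add_divide_distrib del: of_nat_diff)
  also have "\<dots> \<le> cesaro_num \<alpha> m + cesaro_num \<alpha> m * (\<alpha> / real (Suc m))"
    using step \<alpha> cesaro_num_mono[OF step.hyps(1)] less_imp_le[OF cesaro_num_pos[of m]]
    by (intro add_mono mult_mono divide_left_mono) auto
  also have "\<dots> = cesaro_num \<alpha> (Suc m)"
    by (simp add: cesaro_num_Suc algebra_simps)
  finally show ?case .
qed simp

text \<open>Every factor after the \<open>n\<close>-th is at most \<open>exp (\<alpha> / n)\<close>.
  In particular doubling the index costs at most the constant \<open>exp \<alpha>\<close>.\<close>

lemma cesaro_num_growth_upper:
  assumes "n \<le> m" "0 < n"
  shows "cesaro_num \<alpha> m \<le> cesaro_num \<alpha> n * exp (\<alpha> * real (m - n) / real n)"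
  using assms(1)
proof (induction m rule: dec_induct)
  case (step m)
  have "1 + \<alpha> / real (Suc m) \<le> exp (\<alpha> / real (Suc m))"
    by (rule exp_ge_add_one_self)
  also have "\<dots> \<le> exp (\<alpha> / real n)"
    using step \<alpha> assms by (auto intro!: divide_left_mono)
  finally have "cesaro_num \<alpha> (Suc m) \<le> (cesaro_num \<alpha> n * exp (\<alpha> * real (m - n) / real n)) * exp (\<alpha> / real n)"
    unfolding cesaro_num_Suc using step \<alpha> less_imp_le[OF cesaro_num_pos] by (intro mult_mono) auto
  also have "\<dots> = cesaro_num \<alpha> n * exp (\<alpha> * real (Suc m - n) / real n)"
    using step.hyps by (simp add: Suc_diff_le diff_divide_distrib add_divide_distrib algebra_simps flip: exp_add)
  finally show ?case .
qed simp

text \<open>The difference of the cut-offs vanishes unless \<open>n div 2 < m < 2 * n\<close>, so on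
  its support \<open>m\<close> is comparable with \<open>n\<close>, and the bounds for heights and
  increments hold with \<open>B\<close> a multiple of \<open>cesaro_num \<alpha> n\<close>. In
  \<open>D\<close>, the factor \<open>exp \<alpha>\<close> comes from doubling the index, 4 from the
  slopes of the two cut-offs and \<open>2 * \<alpha>\<close> from the relative increments of the
  Cesaro numbers.\<close>

lemma cesaro_dyadic_piece:
  assumes n: "n > 0"
  defines "u \<equiv> \<lambda>m. cesaro_num \<alpha> m * (cutoff n m - cutoff (n div 2) m)"
    and "D \<equiv> exp \<alpha> * (4 + 2 * \<alpha>)"
  shows "(\<integral>t. norm (\<Sum>m\<le>2*n. of_real (u m) * ee t ^ m) \<partial>circ) \<le> 3 * (D * cesaro_num \<alpha> n)"
proof (rule L1_norm_trig_poly_le[OF n])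
  let ?c = "\<lambda>m. cutoff n m - cutoff (n div 2) m"
  have c1: "\<bar>?c m\<bar> \<le> 1" for m
    using cutoff_bounds[of n m] cutoff_bounds[of "n div 2" m] by linarith
  have "cesaro_num \<alpha> (2 * n) \<le> cesaro_num \<alpha> n * exp (\<alpha> * real (2 * n - n) / real n)"
    using n by (intro cesaro_num_growth_upper) auto
  then have A2: "cesaro_num \<alpha> (2 * n) \<le> exp \<alpha> * cesaro_num \<alpha> n"
    using n by (simp add: mult_ac)
  have A: "cesaro_num \<alpha> m \<le> exp \<alpha> * cesaro_num \<alpha> n" if "m \<le> 2 * n" for m
    using cesaro_num_mono[OF that] A2 by simp
  have E: "exp \<alpha> * cesaro_num \<alpha> n > 0" using cesaro_num_pos[of n] by simp
  show "u 0 = 0" by (simp add: u_def cutoff_def)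
  show "u (2 * n) = 0" using n by (simp add: u_def cutoff_def)
  show "D * cesaro_num \<alpha> n > 0" using cesaro_num_pos[of n] \<alpha> by (simp add: D_def)
  show "\<bar>u m\<bar> \<le> D * cesaro_num \<alpha> n" if m: "m \<le> 2 * n" for m
  proof -
    have "\<bar>u m\<bar> = cesaro_num \<alpha> m * \<bar>?c m\<bar>"
      using cesaro_num_pos[of m] by (simp add: u_def abs_mult)
    also have "\<dots> \<le> (exp \<alpha> * cesaro_num \<alpha> n) * 1"
      using A[OF m] c1 E by (intro mult_mono) auto
    also have "\<dots> \<le> (exp \<alpha> * cesaro_num \<alpha> n) * (4 + 2 * \<alpha>)"
      using E \<alpha> by (intro mult_left_mono) auto
    finally show ?thesis by (simp add: D_def mult_ac)
  qed
  show "\<bar>u (Suc m) - u m\<bar> \<le> D * cesaro_num \<alpha> n / real n" if m: "m < 2 * n" for m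
  proof -
    \<comment> \<open>The constant 3 in place of 2 is the price of rounding in
      \<open>n div 2\<close>; it is attained at \<open>n = 3\<close>.\<close>
    have "1 / max 1 (real (n div 2)) \<le> 3 / real n"
    proof -
      have "real n \<le> 3 * max 1 (real (n div 2))"
        by (cases "n < 2"; linarith)
      then show ?thesis using n by (simp add: field_simps)
    qed
    moreover have "1 / max 1 (real n) = 1 / real n" using n by simp
    ultimately have dc: "\<bar>?c (Suc m) - ?c m\<bar> \<le> 4 / real n"
      using cutoff_lipschitz[of n m] cutoff_lipschitz[of "n div 2" m] by linarith
    have 1: "cesaro_num \<alpha> (Suc m) * \<bar>?c (Suc m) - ?c m\<bar> \<le> (exp \<alpha> * cesaro_num \<alpha> n) * (4 / real n)"
      using dc A[of "Suc m"] m E by (intro mult_mono) auto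
    have 2: "cesaro_num \<alpha> m * (\<alpha> / real (Suc m)) * \<bar>?c m\<bar> \<le> (exp \<alpha> * cesaro_num \<alpha> n) * (2 * \<alpha> / real n)"
    proof (cases "m \<le> n div 2")
      case True
      then have "?c m = 0" by (simp add: cutoff_def)
      then show ?thesis using \<alpha> E by simp
    next
      case False
      then have "n \<le> 2 * Suc m" by presburger
      then have "real n \<le> 2 * real (Suc m)" by linarith
      then have "\<alpha> / real (Suc m) \<le> 2 * \<alpha> / real n"
        using \<alpha> n mult_left_mono[of "real n" "2 * real (Suc m)" \<alpha>] by (simp add: field_simps del: of_nat_Suc)
      then have "cesaro_num \<alpha> m * (\<alpha> / real (Suc m)) * \<bar>?c m\<bar> \<le> (exp \<alpha> * cesaro_num \<alpha> n) * (2 * \<alpha> / real n) * 1"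
        using A[of m] m E \<alpha> c1[of m] by (intro mult_mono) auto
      then show ?thesis by simp
    qed
    \<comment> \<open>Product rule for differences: one term carries the increment of the cut-offs,
      the other that of the Cesaro numbers.\<close>
    have "u (Suc m) - u m = cesaro_num \<alpha> (Suc m) * (?c (Suc m) - ?c m) + cesaro_num \<alpha> m * (\<alpha> / real (Suc m)) * ?c m"
      unfolding u_def cesaro_num_Suc by (simp add: algebra_simps)
    also have "\<bar>\<dots>\<bar> \<le> \<bar>cesaro_num \<alpha> (Suc m) * (?c (Suc m) - ?c m)\<bar> + \<bar>cesaro_num \<alpha> m * (\<alpha> / real (Suc m)) * ?c m\<bar>"
      by (rule abs_triangle_ineq)
    also have "\<dots> = cesaro_num \<alpha> (Suc m) * \<bar>?c (Suc m) - ?c m\<bar> + cesaro_num \<alpha> m * (\<alpha> / real (Suc m)) * \<bar>?c m\<bar>"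
      using cesaro_num_pos[of m] cesaro_num_pos[of "Suc m"] \<alpha> by (simp add: abs_mult del: of_nat_Suc)
    also have "\<dots> \<le> (exp \<alpha> * cesaro_num \<alpha> n) * (4 / real n) + (exp \<alpha> * cesaro_num \<alpha> n) * (2 * \<alpha> / real n)"
      using 1 2 by (rule add_mono)
    also have "\<dots> = D * cesaro_num \<alpha> n / real n"
      by (simp add: D_def add_divide_distrib algebra_simps)
    finally show ?thesis .
  qed
qed

text \<open>Halving \<open>n\<close> shrinks the weights by the factor \<open>1 + \<alpha> / 2 > 1\<close>, so the norms of the
  dyadic pieces sum up like a geometric series.\<close>
lemma cesaro_trig_poly_bound:
  defines "C \<equiv> 3 * (exp \<alpha> * (4 + 2 * \<alpha>)) * (1 + 2 / \<alpha>)"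
  shows "(\<integral>t. norm (\<Sum>m\<le>2*n. of_real (cesaro_num \<alpha> m * cutoff n m) * ee t ^ m) \<partial>circ) \<le> C * cesaro_num \<alpha> n"
proof (induction n rule: less_induct)
  case (less n)
  define D where "D = 3 * (exp \<alpha> * (4 + 2 * \<alpha>))"
  \<comment> \<open>This is the solution of \<open>C = C / (1 + \<alpha> / 2) + D\<close>, the
    recursion produced by splitting off one dyadic piece.\<close>
  have C: "C = D * (1 + 2 / \<alpha>)" by (simp add: C_def D_def)
  show ?case
  proof (cases "n = 0")
    case True
    have "1 * 4 \<le> exp \<alpha> * (4 + 2 * \<alpha>)"
      using \<alpha> by (intro mult_mono) auto
    then have "1 * 1 \<le> C"
      unfolding C_def using \<alpha> by (intro mult_mono) auto
    then show ?thesis using True by (simp add: cutoff_def)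
  next
    case False
    define n' where "n' = n div 2"
    have n': "n' < n" "n' \<le> n" using False by (auto simp: n'_def)
    let ?P = "\<lambda>c t. \<Sum>m\<le>2*n. complex_of_real (cesaro_num \<alpha> m * c m) * ee t ^ m"
    have split: "?P (cutoff n) t = ?P (cutoff n') t + ?P (\<lambda>m. cutoff n m - cutoff n' m) t" for t
      by (simp add: sum.distrib[symmetric] algebra_simps)
    have short: "?P (cutoff n') t = (\<Sum>m\<le>2*n'. complex_of_real (cesaro_num \<alpha> m * cutoff n' m) * ee t ^ m)" for t
      using n' by (intro sum.mono_neutral_right) (auto simp: cutoff_def)
    have "cesaro_num \<alpha> n' * (1 + \<alpha> / 2) \<le> cesaro_num \<alpha> n' * (1 + \<alpha> * real (n - n') / real n)"
    proof -
      have "real n \<le> 2 * real (n - n')" unfolding n'_def by linarith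
      then have "\<alpha> * real n \<le> \<alpha> * (2 * real (n - n'))" using \<alpha> by (intro mult_left_mono) auto
      then have "\<alpha> / 2 \<le> \<alpha> * real (n - n') / real n" using False by (simp add: field_simps)
      then show ?thesis using cesaro_num_pos[of n'] by simp
    qed
    also have "\<dots> \<le> cesaro_num \<alpha> n"
      using n' by (intro cesaro_num_growth_lower) auto
    finally have grow: "cesaro_num \<alpha> n' * (1 + \<alpha> / 2) \<le> cesaro_num \<alpha> n" .
    have "(\<integral>t. norm (?P (cutoff n) t) \<partial>circ)
        \<le> (\<integral>t. norm (?P (cutoff n') t) + norm (?P (\<lambda>m. cutoff n m - cutoff n' m) t) \<partial>circ)"
      unfolding split by (intro integral_mono norm_triangle_ineq integrable_circ continuous_intros)
    also have "\<dots> = (\<integral>t. norm (?P (cutoff n') t) \<partial>circ) + (\<integral>t. norm (?P (\<lambda>m. cutoff n m - cutoff n' m) t) \<partial>circ)"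
      by (intro Bochner_Integration.integral_add integrable_circ continuous_intros)
    also have "\<dots> \<le> C * cesaro_num \<alpha> n' + D * cesaro_num \<alpha> n"
      unfolding short using less.IH[OF n'(1)] cesaro_dyadic_piece[of n] False
      by (intro add_mono) (auto simp: n'_def D_def)
    also have "\<dots> = D * (2 / \<alpha>) * (cesaro_num \<alpha> n' * (1 + \<alpha> / 2)) + D * cesaro_num \<alpha> n"
      using \<alpha> by (simp add: C field_simps)
    also have "\<dots> \<le> D * (2 / \<alpha>) * cesaro_num \<alpha> n + D * cesaro_num \<alpha> n"
      using \<alpha> grow by (intro add_mono mult_left_mono) (auto simp: D_def)
    also have "\<dots> = C * cesaro_num \<alpha> n"
      by (simp add: C algebra_simps)
    finally show ?thesis .
  qed
qed

section \<open>Binomial weights as quotients of Cesaro numbers\<close>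

lemma cesaro_weight_prod:
  "cesaro_weight \<alpha> n k = (\<Prod>i<k. (real n - real i) / (real n + \<alpha> - real i))"
  unfolding cesaro_weight_def binomial_gbinomial gbinomial_prod_rev
  by (simp add: prod_dividef lessThan_atLeast0)

lemma cesaro_weight_Suc:
  "cesaro_weight \<alpha> n (Suc k) = cesaro_weight \<alpha> n k * ((real n - real k) / (real n + \<alpha> - real k))"
  by (simp add: cesaro_weight_prod)

lemma cesaro_weight_0 [simp]: "cesaro_weight \<alpha> n 0 = 1"
  by (simp add: cesaro_weight_prod)

lemma cesaro_weight_eq_0: "n < k \<Longrightarrow> cesaro_weight \<alpha> n k = 0"
  by (simp add: cesaro_weight_def)

lemma cesaro_weight_bounds: "0 \<le> cesaro_weight \<alpha> n k" "cesaro_weight \<alpha> n k \<le> 1"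
proof -
  have "0 \<le> cesaro_weight \<alpha> n k \<and> cesaro_weight \<alpha> n k \<le> 1"
  proof (cases "k \<le> n")
    case True
    then have "0 \<le> (real n - real i) / (real n + \<alpha> - real i) \<and> (real n - real i) / (real n + \<alpha> - real i) \<le> 1"
      if "i < k" for i using that \<alpha> by (auto simp: field_simps)
    then show ?thesis
      unfolding cesaro_weight_prod by (auto intro!: prod_nonneg prod_le_1)
  qed (simp add: cesaro_weight_eq_0)
  then show "0 \<le> cesaro_weight \<alpha> n k" "cesaro_weight \<alpha> n k \<le> 1" by auto
qed

lemma cesaro_weight_tendsto_1: "(\<lambda>n. cesaro_weight \<alpha> n k) \<longlonglongrightarrow> 1"
proof -
  have "(\<lambda>n. (real n - real i) / (real n + \<alpha> - real i)) \<longlonglongrightarrow> 1" for i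
    by real_asymp
  then have "(\<lambda>n. \<Prod>i<k. (real n - real i) / (real n + \<alpha> - real i)) \<longlonglongrightarrow> (\<Prod>i<k. 1)"
    by (intro tendsto_prod)
  then show ?thesis by (simp add: cesaro_weight_prod)
qed

text \<open>The product telescopes: the factor \<open>(n - k) / (n + \<alpha> - k)\<close> that
  enters the weight at step \<open>k\<close> is the reciprocal of the last factor
  \<open>1 + \<alpha> / (n - k)\<close> of \<open>cesaro_num \<alpha> (n - k)\<close>.\<close>

lemma cesaro_weight_eq_quotient:
  "k \<le> n \<Longrightarrow> cesaro_weight \<alpha> n k = cesaro_num \<alpha> (n - k) / cesaro_num \<alpha> n"
proof (induction k)
  case 0
  then show ?case using cesaro_num_pos[of n] by simp
next
  case (Suc k)
  have "n - k = Suc (n - Suc k)" using Suc.prems by simp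
  then have "cesaro_num \<alpha> (n - k) = cesaro_num \<alpha> (n - Suc k) * (1 + \<alpha> / real (n - k))"
    by (metis cesaro_num_Suc)
  moreover have "(1 + \<alpha> / real (n - k)) * ((real n - real k) / (real n + \<alpha> - real k)) = 1"
  proof -
    define d where "d = real n - real k"
    have d: "d > 0" "real (n - k) = d" "real n + \<alpha> - real k = d + \<alpha>"
      using Suc.prems by (auto simp: d_def)
    have "1 + \<alpha> / d = (d + \<alpha>) / d" "d + \<alpha> \<noteq> 0"
      using d(1) \<alpha> by (simp_all add: add_divide_distrib)
    then show ?thesis unfolding d(2,3) d_def[symmetric] using d(1) by simp
  qed
  ultimately have "cesaro_num \<alpha> (n - k) * ((real n - real k) / (real n + \<alpha> - real k)) = cesaro_num \<alpha> (n - Suc k)"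
    by (metis mult.assoc mult.right_neutral)
  moreover have "cesaro_weight \<alpha> n k = cesaro_num \<alpha> (n - k) / cesaro_num \<alpha> n"
    using Suc by simp
  ultimately show ?case
    unfolding cesaro_weight_Suc by (metis times_divide_eq_left)
qed

text \<open>The factor \<open>cnj (ee t ^ n)\<close> in the kernel makes \<open>ee t ^ k\<close>
  pick out the coefficient with index \<open>m = n - k\<close>. For \<open>0 \<le> k \<le> n\<close>
  this index lies on the plateau of the cut-off, so the coefficient is the exact weight; the altered
  coefficients \<open>m > n\<close> belong to negative \<open>k\<close> and are not tested.\<close>

lemma cesaro_kernel_exists:
  obtains C where "C > 0"
    "\<And>n. \<exists>\<kappa>. continuous_on UNIV \<kappa> \<and> (\<integral>t. norm (\<kappa> t) \<partial>circ) \<le> C \<and>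
        (\<forall>k. (\<integral>t. ee t ^ k * \<kappa> t \<partial>circ) = of_real (cesaro_weight \<alpha> n k))"
proof
  define C where "C = 3 * (exp \<alpha> * (4 + 2 * \<alpha>)) * (1 + 2 / \<alpha>)"
  show "C > 0" using \<alpha> by (simp add: C_def add_pos_pos)
  fix n
  define v where "v m = cesaro_num \<alpha> m * cutoff n m" for m
  define P where "P t = (\<Sum>m\<le>2*n. of_real (v m) * ee t ^ m)" for t
  define \<kappa> where "\<kappa> t = cnj (ee t ^ n) * P t / of_real (cesaro_num \<alpha> n)" for t
  have [simp]: "cesaro_num \<alpha> n \<noteq> 0" using cesaro_num_pos[of n] by simp
  have "continuous_on UNIV \<kappa>"
    unfolding \<kappa>_def P_def by (intro continuous_intros) auto
  moreover have "(\<integral>t. norm (\<kappa> t) \<partial>circ) \<le> C"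
  proof -
    have "(\<integral>t. norm (\<kappa> t) \<partial>circ) = (\<integral>t. norm (P t) / cesaro_num \<alpha> n \<partial>circ)"
      using cesaro_num_pos[of n] by (simp add: \<kappa>_def norm_divide norm_mult norm_power)
    also have "\<dots> = (\<integral>t. norm (P t) \<partial>circ) / cesaro_num \<alpha> n"
      by simp
    also have "\<dots> \<le> C"
      using cesaro_trig_poly_bound[of n] cesaro_num_pos[of n]
      by (simp add: P_def v_def C_def pos_divide_le_eq)
    finally show ?thesis .
  qed
  moreover have "(\<integral>t. ee t ^ k * \<kappa> t \<partial>circ) = of_real (cesaro_weight \<alpha> n k)" for k
  proof -
    have "(\<integral>t. ee t ^ k * \<kappa> t \<partial>circ)
        = (\<integral>t. (\<Sum>m\<le>2*n. of_real (v m / cesaro_num \<alpha> n) * (ee t ^ (k + m) * cnj (ee t ^ n))) \<partial>circ)"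
      by (intro Bochner_Integration.integral_cong refl)
        (simp add: \<kappa>_def P_def sum_distrib_left sum_divide_distrib power_add mult_ac)
    also have "\<dots> = (\<Sum>m\<le>2*n. of_real (v m / cesaro_num \<alpha> n) * (\<integral>t. ee t ^ (k + m) * cnj (ee t ^ n) \<partial>circ))"
      by (subst Bochner_Integration.integral_sum, (intro integrable_circ continuous_intros)[1],
          intro sum.cong refl integral_mult_right_zero)
    also have "\<dots> = (\<Sum>m\<le>2*n. if k + m = n then of_real (v m / cesaro_num \<alpha> n) else 0)"
      unfolding integral_ee_mult_cnj by (intro sum.cong) auto
    also have "\<dots> = of_real (cesaro_weight \<alpha> n k)"
    proof (cases "k \<le> n")
      case True
      then have "(\<Sum>m\<le>2*n. if k + m = n then of_real (v m / cesaro_num \<alpha> n) else 0)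
          = (\<Sum>m\<le>2*n. if m = n - k then complex_of_real (v m / cesaro_num \<alpha> n) else 0)"
        by (intro sum.cong if_cong) auto
      then show ?thesis
        using True by (simp add: cesaro_weight_eq_quotient v_def cutoff_def)
    qed (auto simp: cesaro_weight_eq_0 intro!: sum.neutral)
    finally show ?thesis .
  qed
  ultimately show "\<exists>\<kappa>. continuous_on UNIV \<kappa> \<and> (\<integral>t. norm (\<kappa> t) \<partial>circ) \<le> C \<and>
        (\<forall>k. (\<integral>t. ee t ^ k * \<kappa> t \<partial>circ) = of_real (cesaro_weight \<alpha> n k))"
    by blast
qed

end

section \<open>Coefficient multipliers as convolutions\<close>

text \<open>Convergence at the real point halfway between \<open>norm z\<close> and 1 forces
  absolute convergence at \<open>z\<close>.\<close>

lemma powser_summable_norm: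
  fixes a :: "nat \<Rightarrow> complex"
  assumes "\<And>z. norm z < 1 \<Longrightarrow> (\<lambda>k. a k * z ^ k) sums g z" "norm z < 1"
  shows "summable (\<lambda>k. norm (a k * z ^ k))"
proof (rule powser_insidea)
  show "summable (\<lambda>k. a k * of_real ((1 + norm z) / 2) ^ k)"
    using assms(2) by (intro sums_summable[OF assms(1)]) (simp only: norm_of_real, simp)
  show "norm z < norm (of_real ((1 + norm z) / 2) :: complex)"
    using assms(2) by (simp only: norm_of_real) simp
qed

lemma taylor_coeff_sums:
  assumes "f holomorphic_on ball 0 1" "norm z < 1"
  shows "(\<lambda>k. taylor_coeff f k * z ^ k) sums f z"
  using holomorphic_power_series[OF assms(1), of z] assms(2) by (simp add: taylor_coeff_def)

lemma taylor_coeff_deriv: "taylor_coeff (deriv f) k = of_nat (Suc k) * taylor_coeff f (Suc k)"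
proof -
  have "fact (Suc k) = of_nat (Suc k) * (fact k :: complex)" by simp
  then show ?thesis
    unfolding taylor_coeff_def of_nat_fact funpow_Suc_right o_apply
    by (simp del: fact_Suc of_nat_Suc)
qed

lemma sigma_mean_sums:
  "(\<lambda>k. of_real (cesaro_weight \<alpha> n k) * taylor_coeff g k * z ^ k) sums sigma_mean \<alpha> n g z"
  unfolding sigma_mean_def cesaro_weight_def[symmetric]
  by (rule sums_finite) (auto simp: cesaro_weight_def)

lemma sigma_mean_holomorphic: "sigma_mean \<alpha> n g holomorphic_on A"
  unfolding sigma_mean_def[abs_def] by (intro holomorphic_intros)

text \<open>The factor \<open>k\<close> from differentiation is absorbed by the coefficients of
  \<open>deriv g\<close>, while the weight keeps its old index. The derivative is therefore a
  multiplier of the same type, with weights shifted by one.\<close>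

lemma deriv_sigma_mean_sums:
  "(\<lambda>k. of_real (cesaro_weight \<alpha> n (Suc k)) * taylor_coeff (deriv g) k * z ^ k) sums deriv (sigma_mean \<alpha> n g) z"
proof -
  let ?W = "\<lambda>k. complex_of_real (cesaro_weight \<alpha> n k)"
  have "(sigma_mean \<alpha> n g has_field_derivative
      (\<Sum>k=0..n. ?W k * taylor_coeff g k * (of_nat k * z ^ (k - Suc 0)))) (at z)"
    unfolding sigma_mean_def[abs_def] cesaro_weight_def[symmetric]
    by (intro DERIV_sum) (auto intro!: derivative_eq_intros)
  then have "deriv (sigma_mean \<alpha> n g) z = (\<Sum>k=0..n. ?W k * taylor_coeff g k * (of_nat k * z ^ (k - Suc 0)))"
    by (rule DERIV_imp_deriv)
  also have "\<dots> = (\<Sum>k<n. ?W (Suc k) * taylor_coeff (deriv g) k * z ^ k)"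
    by (simp add: atLeast0AtMost sum.atMost_shift taylor_coeff_deriv mult_ac del: of_nat_Suc)
  also have "(\<lambda>k. ?W (Suc k) * taylor_coeff (deriv g) k * z ^ k) sums \<dots>"
    by (rule sums_finite) (auto simp: cesaro_weight_def)
  finally show ?thesis .
qed

lemma continuous_on_circle:
  assumes "continuous_on (ball 0 1) g" "norm z < 1"
  shows "continuous_on UNIV (\<lambda>t. g (z * ee t))"
  using assms by (intro continuous_on_compose2[OF assms(1)] continuous_intros) (auto simp: norm_mult)

text \<open>Rotating the argument by \<open>ee t\<close> multiplies the \<open>k\<close>-th term by
  \<open>ee t ^ k\<close>. The series converges absolutely, with norms independent of
  \<open>t\<close>, so it can be integrated term by term.\<close>

lemma kernel_integral_sums:
  fixes g :: "complex \<Rightarrow> complex"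
  assumes g: "\<And>z. norm z < 1 \<Longrightarrow> (\<lambda>k. a k * z ^ k) sums g z"
    and \<kappa>: "continuous_on UNIV \<kappa>" and z: "norm z < 1"
  shows "(\<lambda>k. (\<integral>t. ee t ^ k * \<kappa> t \<partial>circ) * a k * z ^ k) sums (\<integral>t. g (z * ee t) * \<kappa> t \<partial>circ)"
proof -
  define f where "f k t = (a k * z ^ k) * (ee t ^ k * \<kappa> t)" for k t
  have int: "integrable circ (f k)" for k
    unfolding f_def by (intro integrable_circ continuous_intros \<kappa>)
  have nf: "norm (f k t) = norm (a k * z ^ k) * norm (\<kappa> t)" for k t
    by (simp add: f_def norm_mult norm_power)
  note sm = powser_summable_norm[OF g z]
  have "f k t = a k * (z * ee t) ^ k * \<kappa> t" for k t
    by (simp add: f_def power_mult_distrib)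
  then have "(\<lambda>k. f k t) sums (g (z * ee t) * \<kappa> t)" for t
    using sums_mult2[OF g[of "z * ee t"], of "\<kappa> t"] z by (simp add: norm_mult)
  then have "(\<Sum>k. f k t) = g (z * ee t) * \<kappa> t" for t
    by (simp add: sums_iff)
  moreover have "(\<lambda>k. integral\<^sup>L circ (f k)) sums (\<integral>t. (\<Sum>k. f k t) \<partial>circ)"
    by (rule sums_integral[OF int]) (auto simp: nf intro!: summable_mult2[OF sm])
  moreover have "integral\<^sup>L circ (f k) = (\<integral>t. ee t ^ k * \<kappa> t \<partial>circ) * a k * z ^ k" for k
    unfolding f_def integral_mult_right_zero by (simp only: mult_ac)
  ultimately show ?thesis by simp
qed

text \<open>Only the circle through \<open>z\<close> enters, so a bound that depends on the radius
  is preserved up to the norm of the kernel. This is what makes the estimate compatible with the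
  Bloch weight.\<close>

lemma kernel_integral_norm_le:
  fixes g :: "complex \<Rightarrow> complex"
  assumes g: "continuous_on (ball 0 1) g" and \<kappa>: "continuous_on UNIV \<kappa>" and z: "norm z < 1"
    and M: "\<And>w. norm w = norm z \<Longrightarrow> norm (g w) \<le> M"
  shows "norm (\<integral>t. g (z * ee t) * \<kappa> t \<partial>circ) \<le> M * (\<integral>t. norm (\<kappa> t) \<partial>circ)"
proof -
  have "norm (\<integral>t. g (z * ee t) * \<kappa> t \<partial>circ) \<le> (\<integral>t. norm (g (z * ee t) * \<kappa> t) \<partial>circ)"
    by (rule integral_norm_bound)
  also have "\<dots> \<le> (\<integral>t. M * norm (\<kappa> t) \<partial>circ)"
    using M by (intro integral_mono integrable_circ continuous_intros \<kappa> continuous_on_circle[OF g z])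
      (auto simp: norm_mult intro!: mult_right_mono)
  finally show ?thesis by simp
qed

lemma measurable_ee [measurable]: "ee \<in> borel_measurable borel" "ee \<in> borel_measurable circ"
proof -
  show "ee \<in> borel_measurable borel"
    by (intro borel_measurable_continuous_onI continuous_on_ee continuous_on_id)
  then show "ee \<in> borel_measurable circ"
    unfolding circ_def by (intro measurable_restrict_space1) simp
qed

text \<open>An instance of Minkowski's integral inequality: after an exchange of the integrals by
  Tonelli, the inner one runs over a rotated copy of the annulus and does not depend on
  \<open>t\<close>.\<close>

lemma kernel_integral_L1_annulus:
  fixes s :: real and g :: "complex \<Rightarrow> complex"
  defines "A \<equiv> {z::complex. s \<le> norm z \<and> norm z < 1}"
  assumes g: "continuous_on (ball 0 1) g" and \<kappa>: "continuous_on UNIV \<kappa>"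
  shows "(\<integral>\<^sup>+z\<in>A. norm (\<integral>t. g (z * ee t) * \<kappa> t \<partial>circ) \<partial>lborel)
      \<le> ennreal (\<integral>t. norm (\<kappa> t) \<partial>circ) * (\<integral>\<^sup>+z\<in>A. norm (g z) \<partial>lborel)"
proof -
  interpret pair_sigma_finite "lborel :: complex measure" circ
    by (rule pair_sigma_finite.intro) (rule sigma_finite_lborel circ.sigma_finite_measure_axioms)+
  have [measurable]: "A \<in> sets borel" unfolding A_def by measurable
  have [measurable]: "\<kappa> \<in> borel_measurable circ"
    unfolding circ_def by (intro measurable_restrict_space1) (use \<kappa> borel_measurable_continuous_onI in auto)
  define h where "h z = indicator A z *\<^sub>R g z" for z
  have "(\<lambda>z. indicator A z *\<^sub>R g z) \<in> borel_measurable borel"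
    using g by (intro borel_measurable_continuous_on_indicator) (auto simp: A_def intro: continuous_on_subset)
  then have [measurable]: "h \<in> borel_measurable borel" by (simp add: h_def[abs_def])
  define F where "F z = ennreal (norm (h z))" for z
  have [measurable]: "F \<in> borel_measurable borel" unfolding F_def[abs_def] by measurable
  have F: "F z = ennreal (norm (g z)) * indicator A z" for z
    by (simp add: F_def h_def split: split_indicator)
  have "(\<integral>\<^sup>+z\<in>A. norm (\<integral>t. g (z * ee t) * \<kappa> t \<partial>circ) \<partial>lborel)
      \<le> (\<integral>\<^sup>+z. \<integral>\<^sup>+t. F (ee t * z) * ennreal (norm (\<kappa> t)) \<partial>circ \<partial>lborel)"
  proof (rule nn_integral_mono)
    fix z :: complex
    show "ennreal (norm (\<integral>t. g (z * ee t) * \<kappa> t \<partial>circ)) * indicator A z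
        \<le> (\<integral>\<^sup>+t. F (ee t * z) * ennreal (norm (\<kappa> t)) \<partial>circ)"
    proof (cases "z \<in> A")
      case True
      then have z: "norm z < 1" and "ee t * z \<in> A" for t by (auto simp: A_def norm_mult)
      then have "F (ee t * z) * ennreal (norm (\<kappa> t)) = norm (g (z * ee t) * \<kappa> t)" for t
        by (simp add: F norm_mult ennreal_mult mult_ac)
      moreover have "integrable circ (\<lambda>t. g (z * ee t) * \<kappa> t)"
        by (intro integrable_circ continuous_intros \<kappa> continuous_on_circle[OF g z])
      ultimately show ?thesis
        using True integral_norm_bound_ennreal by simp
    qed simp
  qed
  also have "\<dots> = (\<integral>\<^sup>+t. \<integral>\<^sup>+z. F (ee t * z) * ennreal (norm (\<kappa> t)) \<partial>lborel \<partial>circ)"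
    by (rule Fubini'[symmetric]) measurable
  also have "\<dots> = (\<integral>\<^sup>+t. ennreal (norm (\<kappa> t)) * (\<integral>\<^sup>+z. F z \<partial>lborel) \<partial>circ)"
  proof (rule nn_integral_cong)
    fix t
    have "(\<integral>\<^sup>+z. F (ee t * z) * ennreal (norm (\<kappa> t)) \<partial>lborel) = (\<integral>\<^sup>+z. F (ee t * z) \<partial>lborel) * ennreal (norm (\<kappa> t))"
      by (rule nn_integral_multc) measurable
    also have "(\<integral>\<^sup>+z. F (ee t * z) \<partial>lborel) = (\<integral>\<^sup>+z. F z \<partial>lborel)"
      by (rule nn_integral_lborel_rotate) auto
    finally show "(\<integral>\<^sup>+z. F (ee t * z) * ennreal (norm (\<kappa> t)) \<partial>lborel) = ennreal (norm (\<kappa> t)) * (\<integral>\<^sup>+z. F z \<partial>lborel)"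
      by (simp only: mult.commute)
  qed
  also have "\<dots> = (\<integral>\<^sup>+t. ennreal (norm (\<kappa> t)) \<partial>circ) * (\<integral>\<^sup>+z. F z \<partial>lborel)"
    by (rule nn_integral_multc) measurable
  also have "(\<integral>\<^sup>+t. ennreal (norm (\<kappa> t)) \<partial>circ) = ennreal (\<integral>t. norm (\<kappa> t) \<partial>circ)"
    by (intro nn_integral_eq_integral integrable_circ continuous_intros \<kappa>) simp
  finally show ?thesis by (simp add: F)
qed

text \<open>For \<open>norm z \<le> s\<close> the difference is at most the sum of
  \<open>|W n k - 1| * norm (a k) * s ^ k\<close>, which no longer involves \<open>z\<close>; it
  tends to 0 by Tannery's theorem. The weights are left general so that the shifted weights of the
  derivative are covered.\<close>

lemma multiplier_uniform_on_compacts: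
  fixes W :: "nat \<Rightarrow> nat \<Rightarrow> real" and g :: "complex \<Rightarrow> complex"
  assumes g: "\<And>z. norm z < 1 \<Longrightarrow> (\<lambda>k. a k * z ^ k) sums g z"
    and G: "\<And>n z. (\<lambda>k. of_real (W n k) * a k * z ^ k) sums G n z"
    and W: "\<And>n k. 0 \<le> W n k" "\<And>n k. W n k \<le> 1" "\<And>k. (\<lambda>n. W n k) \<longlonglongrightarrow> 1"
    and s: "0 \<le> s" "s < 1" and \<epsilon>: "\<epsilon> > 0"
  shows "eventually (\<lambda>n. \<forall>z. norm z \<le> s \<longrightarrow> norm (G n z - g z) \<le> \<epsilon>) sequentially"
proof -
  define M where "M k = norm (a k * of_real s ^ k)" for k
  have M: "summable M"
    unfolding M_def using s by (intro powser_summable_norm[OF g]) auto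
  have W1: "\<bar>W n k - 1\<bar> \<le> 1" for n k
    using W(1,2)[of n k] by linarith
  have bd: "norm (\<bar>W n k - 1\<bar> * M k) \<le> M k" for n k
    using W1 by (simp add: abs_mult M_def mult_left_le_one_le)
  have "(\<lambda>n. \<Sum>k. \<bar>W n k - 1\<bar> * M k) \<longlonglongrightarrow> (\<Sum>k. 0)"
  proof (rule tannerys_theorem[THEN conjunct2, THEN conjunct2])
    show "(\<lambda>n. \<bar>W n k - 1\<bar> * M k) \<longlonglongrightarrow> 0" for k
      using W(3)[of k] by (intro tendsto_mult_left_zero tendsto_rabs_zero) (simp add: LIM_zero_iff)
    show "eventually (\<lambda>(k,n). norm (\<bar>W n k - 1\<bar> * M k) \<le> M k) (at_top \<times>\<^sub>F sequentially)"
      using bd by (intro always_eventually) auto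
  qed (use M in auto)
  then have "eventually (\<lambda>n. (\<Sum>k. \<bar>W n k - 1\<bar> * M k) < \<epsilon>) sequentially"
    using \<epsilon> by (intro order_tendstoD(2)) auto
  then show ?thesis
  proof eventually_elim
    case (elim n)
    show ?case
    proof (intro allI impI)
      fix z :: complex assume z: "norm z \<le> s"
      have sums: "(\<lambda>k. (of_real (W n k) - 1) * (a k * z ^ k)) sums (G n z - g z)"
        using sums_diff[OF G[of n z] g[OF le_less_trans[OF z s(2)]]]
        by (simp only: left_diff_distrib mult_1_left mult.assoc)
      have le: "norm ((of_real (W n k) - 1) * (a k * z ^ k)) \<le> \<bar>W n k - 1\<bar> * M k" for k
      proof -
        have "of_real (W n k) - 1 = (of_real (W n k - 1) :: complex)" by simp
        then have "norm (of_real (W n k) - 1 :: complex) = \<bar>W n k - 1\<bar>"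
          by (simp only: norm_of_real)
        moreover have "norm (a k * z ^ k) \<le> M k"
        proof -
          have "norm z ^ k \<le> s ^ k" using z by (intro power_mono) auto
          then show ?thesis using s by (simp add: M_def norm_mult norm_power mult_left_mono)
        qed
        ultimately show ?thesis
          by (simp only: norm_mult[of "of_real (W n k) - 1"]) (intro mult_left_mono, auto)
      qed
      have sm: "summable (\<lambda>k. \<bar>W n k - 1\<bar> * M k)"
        by (rule summable_comparison_test'[OF M]) (rule bd)
      have "norm (G n z - g z) \<le> (\<Sum>k. \<bar>W n k - 1\<bar> * M k)"
        using norm_suminf_le[of "\<lambda>k. (of_real (W n k) - 1) * (a k * z ^ k)", OF le sm] sums
        by (simp only: sums_iff)
      with elim show "norm (G n z - g z) \<le> \<epsilon>" by simp
    qed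
  qed
qed

section \<open>Convergence in the Bergman and the little Bloch space\<close>

text \<open>Dominated convergence: every point of the disk eventually leaves the shrinking annuli.
  The radii \<open>1 - 1 / Suc n\<close> start at 0 and are thus nonnegative.\<close>

lemma bergman_A1_tail:
  assumes "g \<in> bergman_A1"
  shows "(\<lambda>n. \<integral>z. indicator {z. 1 - 1 / real (Suc n) \<le> norm z \<and> norm z < 1} z * norm (g z) \<partial>lborel) \<longlonglongrightarrow> 0"
proof -
  let ?A = "\<lambda>n. {z::complex. 1 - 1 / real (Suc n) \<le> norm z \<and> norm z < 1}"
  have int: "integrable lborel (\<lambda>z. indicator (ball 0 1) z * norm (g z))"
    using assms by (simp add: bergman_A1_def set_integrable_def)
  have sub: "indicator (?A n) z * norm (g z) = indicator (?A n) z * (indicator (ball 0 1) z * norm (g z))" for n z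
    by (auto split: split_indicator)
  have "(\<lambda>n. \<integral>z. indicator (?A n) z * norm (g z) \<partial>lborel) \<longlonglongrightarrow> (\<integral>z. 0 \<partial>(lborel :: complex measure))"
  proof (rule integral_dominated_convergence)
    show "integrable lborel (\<lambda>z. indicator (ball 0 1) z * norm (g z))" by (rule int)
    show "(\<lambda>z. 0 :: real) \<in> borel_measurable (lborel :: complex measure)" by simp
    show "(\<lambda>z. indicator (?A n) z * norm (g z)) \<in> borel_measurable lborel" for n
    proof -
      note borel_measurable_integrable[OF int, measurable]
      have "?A n \<in> sets lborel" by measurable
      then have "(\<lambda>z. indicator (?A n) z * (indicator (ball 0 1) z * norm (g z))) \<in> borel_measurable lborel"
        by measurable
      then show ?thesis by (simp only: sub[symmetric])
    qed
    show "AE z in lborel. (\<lambda>n. indicator (?A n) z * norm (g z)) \<longlonglongrightarrow> 0"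
    proof (rule AE_I2)
      fix z :: complex
      have "\<exists>N. \<forall>n\<ge>N. z \<notin> ?A n"
      proof (cases "norm z < 1")
        case True
        have "(\<lambda>n. 1 - 1 / real (Suc n)) \<longlonglongrightarrow> 1" by real_asymp
        then have "eventually (\<lambda>n. norm z < 1 - 1 / real (Suc n)) sequentially"
          using True by (rule order_tendstoD(1))
        then show ?thesis by (auto simp: eventually_sequentially not_le)
      qed auto
      then have "eventually (\<lambda>n. indicator (?A n) z * norm (g z) = 0) sequentially"
        by (auto simp: eventually_sequentially split: split_indicator)
      then show "(\<lambda>n. indicator (?A n) z * norm (g z)) \<longlonglongrightarrow> 0"
        by (rule tendsto_eventually)
    qed
    show "AE z in lborel. norm (indicator (?A n) z * norm (g z)) \<le> indicator (ball 0 1) z * norm (g z)" for n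
      by (rule AE_I2) (auto split: split_indicator)
  qed
  then show ?thesis by simp
qed

text \<open>For each \<open>n\<close>, one kernel serves all functions and both formulas. The shift
  of the weights under differentiation shows up as the factor \<open>ee t\<close>, which has modulus
  1, so the bound \<open>C\<close> applies to both.\<close>

lemma sigma_mean_kernel:
  assumes "\<alpha> > 0"
  obtains C where "C > 0"
    "\<And>n. \<exists>\<kappa>. continuous_on UNIV \<kappa> \<and> (\<integral>t. norm (\<kappa> t) \<partial>circ) \<le> C \<and>
       (\<forall>g z. g holomorphic_on ball 0 1 \<longrightarrow> norm z < 1 \<longrightarrow>
         sigma_mean \<alpha> n g z = (\<integral>t. g (z * ee t) * \<kappa> t \<partial>circ) \<and>
         deriv (sigma_mean \<alpha> n g) z = (\<integral>t. deriv g (z * ee t) * (ee t * \<kappa> t) \<partial>circ))"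
proof -
  obtain C where C: "C > 0" and ker: "\<And>n. \<exists>\<kappa>. continuous_on UNIV \<kappa> \<and> (\<integral>t. norm (\<kappa> t) \<partial>circ) \<le> C \<and>
        (\<forall>k. (\<integral>t. ee t ^ k * \<kappa> t \<partial>circ) = of_real (cesaro_weight \<alpha> n k))"
    using cesaro_kernel_exists[OF assms] by blast
  show thesis
  proof
    show "C > 0" by fact
    fix n
    obtain \<kappa> where \<kappa>: "continuous_on UNIV \<kappa>" "(\<integral>t. norm (\<kappa> t) \<partial>circ) \<le> C"
      and coeff: "\<And>k. (\<integral>t. ee t ^ k * \<kappa> t \<partial>circ) = of_real (cesaro_weight \<alpha> n k)"
      using ker[of n] by blast
    have \<kappa>': "continuous_on UNIV (\<lambda>t. ee t * \<kappa> t)"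
      by (intro continuous_intros \<kappa>)
    have coeff': "(\<integral>t. ee t ^ k * (ee t * \<kappa> t) \<partial>circ) = of_real (cesaro_weight \<alpha> n (Suc k))" for k
      using coeff[of "Suc k"] by (simp add: mult_ac)
    have "sigma_mean \<alpha> n g z = (\<integral>t. g (z * ee t) * \<kappa> t \<partial>circ) \<and>
         deriv (sigma_mean \<alpha> n g) z = (\<integral>t. deriv g (z * ee t) * (ee t * \<kappa> t) \<partial>circ)"
      if g: "g holomorphic_on ball 0 1" and z: "norm z < 1" for g z
    proof
      have g': "deriv g holomorphic_on ball 0 1" using g by (intro holomorphic_deriv) auto
      show "sigma_mean \<alpha> n g z = (\<integral>t. g (z * ee t) * \<kappa> t \<partial>circ)"
        using sums_unique2[OF sigma_mean_sums[of \<alpha> n g z]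
          kernel_integral_sums[OF taylor_coeff_sums[OF g] \<kappa>(1) z, unfolded coeff]] by simp
      show "deriv (sigma_mean \<alpha> n g) z = (\<integral>t. deriv g (z * ee t) * (ee t * \<kappa> t) \<partial>circ)"
        using sums_unique2[OF deriv_sigma_mean_sums[of \<alpha> n g z]
          kernel_integral_sums[OF taylor_coeff_sums[OF g'] \<kappa>' z, unfolded coeff']] by simp
    qed
    with \<kappa> show "\<exists>\<kappa>. continuous_on UNIV \<kappa> \<and> (\<integral>t. norm (\<kappa> t) \<partial>circ) \<le> C \<and>
       (\<forall>g z. g holomorphic_on ball 0 1 \<longrightarrow> norm z < 1 \<longrightarrow>
         sigma_mean \<alpha> n g z = (\<integral>t. g (z * ee t) * \<kappa> t \<partial>circ) \<and>
         deriv (sigma_mean \<alpha> n g) z = (\<integral>t. deriv g (z * ee t) * (ee t * \<kappa> t) \<partial>circ))"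
      by blast
  qed
qed

lemma bergman_norm_nonneg: "bergman_norm f \<ge> 0"
  unfolding bergman_norm_def set_lebesgue_integral_def by (intro mult_nonneg_nonneg integral_nonneg) auto

lemma bergman_norm_sigma_mean_tendsto_0:
  assumes \<alpha>: "\<alpha> > 0" and g: "g \<in> bergman_A1"
  shows "(\<lambda>n. bergman_norm (\<lambda>z. sigma_mean \<alpha> n g z - g z)) \<longlonglongrightarrow> 0"
proof -
  obtain C where C: "C > 0" and ker:
    "\<And>n. \<exists>\<kappa>. continuous_on UNIV \<kappa> \<and> (\<integral>t. norm (\<kappa> t) \<partial>circ) \<le> C \<and>
       (\<forall>g z. g holomorphic_on ball 0 1 \<longrightarrow> norm z < 1 \<longrightarrow>
         sigma_mean \<alpha> n g z = (\<integral>t. g (z * ee t) * \<kappa> t \<partial>circ) \<and>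
         deriv (sigma_mean \<alpha> n g) z = (\<integral>t. deriv g (z * ee t) * (ee t * \<kappa> t) \<partial>circ))"
    using sigma_mean_kernel[OF \<alpha>] by blast
  have hol: "g holomorphic_on ball 0 1" and int: "integrable lborel (\<lambda>z. indicator (ball 0 1) z * norm (g z))"
    using g by (simp_all add: bergman_A1_def set_integrable_def)
  have cont: "continuous_on (ball 0 1) g" using hol by (rule holomorphic_on_imp_continuous_on)
  define V where "V = measure lborel (ball (0::complex) 1)"
  have V: "emeasure lborel (ball (0::complex) 1) = ennreal V" "V \<ge> 0"
    unfolding V_def by (intro emeasure_eq_ennreal_measure) (use emeasure_lborel_ball_finite[of "0::complex" 1] in auto)
  show ?thesis
  proof (rule LIMSEQ_I)
    fix \<epsilon> :: real assume \<epsilon>: "\<epsilon> > 0"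
    \<comment> \<open>An error \<open>\<delta>\<close> on the disk of area \<open>V\<close>,
      together with the annulus masses \<open>C * \<delta>\<close> of the mean and
      \<open>\<delta>\<close> of \<open>g\<close>, adds up to \<open>\<epsilon> / 2\<close>.\<close>
    define \<delta> where "\<delta> = \<epsilon> / (2 * (V + C + 1))"
    have \<delta>: "\<delta> > 0" using \<epsilon> C V by (simp add: \<delta>_def)
    obtain N where N: "\<bar>\<integral>z. indicator {z. 1 - 1 / real (Suc N) \<le> norm z \<and> norm z < 1} z * norm (g z) \<partial>lborel\<bar> < \<delta>"
      using LIMSEQ_D[OF bergman_A1_tail[OF g] \<delta>] by auto
    define s where "s = 1 - 1 / real (Suc N)"
    have s: "0 \<le> s" "s < 1" by (auto simp: s_def)
    define A where "A = {z::complex. s \<le> norm z \<and> norm z < 1}"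
    have [measurable]: "A \<in> sets borel" unfolding A_def by measurable
    have Asub: "A \<subseteq> ball 0 1" by (auto simp: A_def)
    have "integrable lborel (\<lambda>z. indicator A z * (indicator (ball 0 1) z * norm (g z)))"
      using integrable_mult_indicator[OF _ int, of A] by simp
    moreover have "indicator A z * (indicator (ball 0 1) z * norm (g z)) = indicator A z * norm (g z)" for z
      using Asub by (auto split: split_indicator)
    ultimately have intA: "integrable lborel (\<lambda>z. indicator A z * norm (g z))" by simp
    have "(\<integral>\<^sup>+z\<in>A. norm (g z) \<partial>lborel) = (\<integral>\<^sup>+z. ennreal (indicator A z * norm (g z)) \<partial>lborel)"
      by (intro nn_integral_cong) (auto split: split_indicator)
    also have "\<dots> = ennreal (\<integral>z. indicator A z * norm (g z) \<partial>lborel)"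
      by (intro nn_integral_eq_integral intA) auto
    also have "\<dots> \<le> ennreal \<delta>"
      using N by (intro ennreal_leI) (simp add: A_def s_def)
    finally have tail: "(\<integral>\<^sup>+z\<in>A. norm (g z) \<partial>lborel) \<le> ennreal \<delta>" .
    have "eventually (\<lambda>n. \<forall>z. norm z \<le> s \<longrightarrow> norm (sigma_mean \<alpha> n g z - g z) \<le> \<delta>) sequentially"
      by (rule multiplier_uniform_on_compacts[OF taylor_coeff_sums[OF hol] sigma_mean_sums])
        (use s \<delta> cesaro_weight_bounds[OF \<alpha>] cesaro_weight_tendsto_1[OF \<alpha>] in auto)
    then obtain n0 where n0: "\<And>n z. n \<ge> n0 \<Longrightarrow> norm z \<le> s \<Longrightarrow> norm (sigma_mean \<alpha> n g z - g z) \<le> \<delta>"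
      by (auto simp: eventually_sequentially)
    have "norm (bergman_norm (\<lambda>z. sigma_mean \<alpha> n g z - g z) - 0) < \<epsilon>" if n: "n \<ge> n0" for n
    proof -
      let ?S = "sigma_mean \<alpha> n g"
      obtain \<kappa> where \<kappa>: "continuous_on UNIV \<kappa>" "(\<integral>t. norm (\<kappa> t) \<partial>circ) \<le> C"
        and S: "\<And>z. norm z < 1 \<Longrightarrow> ?S z = (\<integral>t. g (z * ee t) * \<kappa> t \<partial>circ)"
        using ker[of n] hol by blast
      have meas: "(\<lambda>z. indicator B z *\<^sub>R f z) \<in> borel_measurable borel"
        if "B \<in> sets borel" "B \<subseteq> ball 0 1" "continuous_on (ball 0 1) f" for B and f :: "complex \<Rightarrow> complex"
        using that by (intro borel_measurable_continuous_on_indicator) (auto intro: continuous_on_subset)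
      have measA: "(\<lambda>z. ennreal (norm (f z)) * indicator A z) \<in> borel_measurable lborel"
        if "continuous_on (ball 0 1) f" for f :: "complex \<Rightarrow> complex"
      proof -
        note meas[OF _ Asub that, measurable]
        have "(\<lambda>z. ennreal (norm (indicator A z *\<^sub>R f z))) \<in> borel_measurable lborel"
          by measurable
        also have "(\<lambda>z. ennreal (norm (indicator A z *\<^sub>R f z))) = (\<lambda>z. ennreal (norm (f z)) * indicator A z)"
          by (auto split: split_indicator)
        finally show ?thesis .
      qed
      have mball: "(\<lambda>z. ennreal \<delta> * indicator (ball 0 1) z) \<in> borel_measurable (lborel :: complex measure)"
        by measurable simp
      have contS: "continuous_on (ball 0 1) ?S"
        by (intro holomorphic_on_imp_continuous_on sigma_mean_holomorphic)
      have "(\<integral>\<^sup>+z\<in>A. norm (?S z) \<partial>lborel) = (\<integral>\<^sup>+z\<in>A. norm (\<integral>t. g (z * ee t) * \<kappa> t \<partial>circ) \<partial>lborel)"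
        by (intro nn_integral_cong) (auto simp: A_def S split: split_indicator)
      also have "\<dots> \<le> ennreal (\<integral>t. norm (\<kappa> t) \<partial>circ) * (\<integral>\<^sup>+z\<in>A. norm (g z) \<partial>lborel)"
        unfolding A_def by (rule kernel_integral_L1_annulus[OF cont \<kappa>(1)])
      also have "\<dots> \<le> ennreal C * ennreal \<delta>"
        using \<kappa>(2) tail by (intro mult_mono ennreal_leI) auto
      finally have tailS: "(\<integral>\<^sup>+z\<in>A. norm (?S z) \<partial>lborel) \<le> ennreal C * ennreal \<delta>" .
      have "(\<integral>\<^sup>+z. ennreal (indicator (ball 0 1) z * norm (?S z - g z)) \<partial>lborel)
          \<le> (\<integral>\<^sup>+z. ennreal \<delta> * indicator (ball 0 1) z + (ennreal (norm (?S z)) * indicator A z + ennreal (norm (g z)) * indicator A z) \<partial>lborel)"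
      proof (rule nn_integral_mono)
        fix z
        show "ennreal (indicator (ball 0 1) z * norm (?S z - g z))
            \<le> ennreal \<delta> * indicator (ball 0 1) z + (ennreal (norm (?S z)) * indicator A z + ennreal (norm (g z)) * indicator A z)"
        proof (cases "z \<in> A")
          case True
          have "ennreal (norm (?S z - g z)) \<le> ennreal (norm (?S z) + norm (g z))"
            by (intro ennreal_leI norm_triangle_ineq4)
          then show ?thesis
            using True Asub by (auto simp: add_increasing)
        next
          case False
          then show ?thesis
            using n0[OF n, of z] by (auto simp: A_def intro!: ennreal_leI split: split_indicator)
        qed
      qed
      also have "\<dots> = ennreal \<delta> * ennreal V + ((\<integral>\<^sup>+z\<in>A. norm (?S z) \<partial>lborel) + (\<integral>\<^sup>+z\<in>A. norm (g z) \<partial>lborel))"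
        unfolding nn_integral_add[OF measA[OF contS] measA[OF cont], symmetric] V(1)[symmetric]
        by (subst nn_integral_add[OF mball borel_measurable_add[OF measA[OF contS] measA[OF cont]]])
          (subst nn_integral_cmult_indicator, auto)
      also have "\<dots> \<le> ennreal \<delta> * ennreal V + (ennreal C * ennreal \<delta> + ennreal \<delta>)"
        by (intro add_mono tailS tail order_refl)
      also have "\<dots> = ennreal (\<delta> * (V + C + 1))"
        using \<delta> V C by (simp add: ennreal_mult'[symmetric] ennreal_plus[symmetric] algebra_simps del: ennreal_plus)
      also have "\<delta> * (V + C + 1) = \<epsilon> / 2"
        using V C by (simp add: \<delta>_def field_simps)
      finally have "(\<integral>z. indicator (ball 0 1) z * norm (?S z - g z) \<partial>lborel) \<le> \<epsilon> / 2"
        using \<epsilon> by (intro integral_real_bounded) auto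
      moreover have "bergman_norm (\<lambda>z. ?S z - g z) \<le> 1 * (\<integral>z. indicator (ball 0 1) z * norm (?S z - g z) \<partial>lborel)"
        unfolding bergman_norm_def set_lebesgue_integral_def real_scaleR_def
        using pi_ge_two by (intro mult_right_mono integral_nonneg) auto
      ultimately show ?thesis
        using \<epsilon> bergman_norm_nonneg[of "\<lambda>z. ?S z - g z"] by simp
    qed
    then show "\<exists>n0. \<forall>n\<ge>n0. norm (bergman_norm (\<lambda>z. sigma_mean \<alpha> n g z - g z) - 0) < \<epsilon>" by blast
  qed
qed

text \<open>The weight of index 0 is 1, so the means keep the value at the origin and only the
  derivatives matter. Near the boundary the derivatives of \<open>f\<close> and of its means are
  small separately; inside, their difference is small uniformly.\<close>

lemma bloch_norm_sigma_mean_tendsto_0: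
  assumes \<alpha>: "\<alpha> > 0" and f: "f \<in> little_bloch"
  shows "(\<lambda>n. bloch_norm (\<lambda>z. sigma_mean \<alpha> n f z - f z)) \<longlonglongrightarrow> 0"
proof -
  obtain C where C: "C > 0" and ker:
    "\<And>n. \<exists>\<kappa>. continuous_on UNIV \<kappa> \<and> (\<integral>t. norm (\<kappa> t) \<partial>circ) \<le> C \<and>
       (\<forall>g z. g holomorphic_on ball 0 1 \<longrightarrow> norm z < 1 \<longrightarrow>
         sigma_mean \<alpha> n g z = (\<integral>t. g (z * ee t) * \<kappa> t \<partial>circ) \<and>
         deriv (sigma_mean \<alpha> n g) z = (\<integral>t. deriv g (z * ee t) * (ee t * \<kappa> t) \<partial>circ))"
    using sigma_mean_kernel[OF \<alpha>] by blast
  have hol: "f holomorphic_on ball 0 1"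
    using f by (simp add: little_bloch_def bloch_space_def)
  then have hol': "deriv f holomorphic_on ball 0 1" by (intro holomorphic_deriv) auto
  then have cont': "continuous_on (ball 0 1) (deriv f)" by (rule holomorphic_on_imp_continuous_on)
  show ?thesis
  proof (rule LIMSEQ_I)
    fix \<epsilon> :: real assume \<epsilon>: "\<epsilon> > 0"
    define \<delta> where "\<delta> = \<epsilon> / (2 * (C + 1))"
    have \<delta>: "\<delta> > 0" "(C + 1) * \<delta> = \<epsilon> / 2" using \<epsilon> C by (simp_all add: \<delta>_def field_simps)
    obtain r where r: "r < 1" "\<And>z. r < norm z \<Longrightarrow> norm z < 1 \<Longrightarrow> (1 - (norm z)\<^sup>2) * norm (deriv f z) < \<delta>"
      using f \<delta>(1) unfolding little_bloch_def by blast
    \<comment> \<open>The radius in \<open>little_bloch\<close> may be negative, hence the maximum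
      with 0.\<close>
    have "eventually (\<lambda>n. \<forall>z. norm z \<le> max 0 r \<longrightarrow> norm (deriv (sigma_mean \<alpha> n f) z - deriv f z) \<le> \<epsilon> / 2) sequentially"
      by (rule multiplier_uniform_on_compacts[OF taylor_coeff_sums[OF hol'] deriv_sigma_mean_sums])
        (use r \<epsilon> cesaro_weight_bounds[OF \<alpha>] cesaro_weight_tendsto_1[OF \<alpha>] in auto)
    then obtain n0 where n0: "\<And>n z. n \<ge> n0 \<Longrightarrow> norm z \<le> max 0 r \<Longrightarrow>
        norm (deriv (sigma_mean \<alpha> n f) z - deriv f z) \<le> \<epsilon> / 2"
      by (auto simp: eventually_sequentially)
    have "norm (bloch_norm (\<lambda>z. sigma_mean \<alpha> n f z - f z) - 0) < \<epsilon>" if n: "n \<ge> n0" for n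
    proof -
      let ?S = "sigma_mean \<alpha> n f"
      obtain \<kappa> where \<kappa>: "continuous_on UNIV \<kappa>" "(\<integral>t. norm (\<kappa> t) \<partial>circ) \<le> C"
        and S: "\<And>z. norm z < 1 \<Longrightarrow> deriv ?S z = (\<integral>t. deriv f (z * ee t) * (ee t * \<kappa> t) \<partial>circ)"
        using ker[of n] hol by blast
      have "?S 0 = f 0"
        using sums_unique2[OF sigma_mean_sums[of \<alpha> n f 0]
            powser_sums_zero[of "\<lambda>k. of_real (cesaro_weight \<alpha> n k) * taylor_coeff f k"]] \<alpha>
        by (simp add: taylor_coeff_def cesaro_weight_0)
      moreover have le: "(1 - (norm z)\<^sup>2) * norm (deriv (\<lambda>z. ?S z - f z) z) \<le> \<epsilon> / 2" if z: "z \<in> ball 0 1" for z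
      proof -
        have z1: "norm z < 1" using z by simp
        then have z2: "0 \<le> 1 - (norm z)\<^sup>2" "1 - (norm z)\<^sup>2 \<le> 1"
          by (auto simp: power_le_one)
        have "?S field_differentiable at z" "f field_differentiable at z"
          using sigma_mean_holomorphic[of \<alpha> n f UNIV] hol z
          by (auto simp: holomorphic_on_def at_within_open[of _ "ball 0 1"])
        then have d: "deriv (\<lambda>z. ?S z - f z) z = deriv ?S z - deriv f z" by (rule deriv_diff)
        show ?thesis
        proof (cases "norm z \<le> max 0 r")
          case True
          have "(1 - (norm z)\<^sup>2) * norm (deriv ?S z - deriv f z) \<le> 1 * (\<epsilon> / 2)"
            using z2 n0[OF n True] by (intro mult_mono) auto
          then show ?thesis by (simp add: d)
        next
          case False
          \<comment> \<open>The weight is constant on the circle through \<open>z\<close>, so the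
            smallness of the weighted derivative becomes one bound for \<open>deriv f\<close> on
            that whole circle.\<close>
          define M where "M = \<delta> / (1 - (norm z)\<^sup>2)"
          have pos: "1 - (norm z)\<^sup>2 > 0" using z1 by (simp add: power_less_one_iff abs_square_less_1)
          have M: "norm (deriv f w) \<le> M" if "norm w = norm z" for w
            using less_imp_le[OF r(2)[of w]] that False z1 pos by (simp add: M_def pos_le_divide_eq mult.commute)
          have M0: "0 \<le> M" using M[OF refl] norm_ge_zero order_trans by blast
          have "norm (deriv ?S z) \<le> M * (\<integral>t. norm (ee t * \<kappa> t) \<partial>circ)"
            unfolding S[OF z1]
            by (rule kernel_integral_norm_le[OF cont' _ z1 M]) (intro continuous_intros \<kappa>)
          also have "\<dots> \<le> M * C"
            using \<kappa>(2) M0 by (intro mult_left_mono) (auto simp: norm_mult)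
          finally have "norm (deriv ?S z - deriv f z) \<le> M * C + M"
            using M[OF refl] norm_triangle_ineq4[of "deriv ?S z" "deriv f z"] by linarith
          then have "(1 - (norm z)\<^sup>2) * norm (deriv ?S z - deriv f z) \<le> (1 - (norm z)\<^sup>2) * (M * (C + 1))"
            using z2 by (intro mult_left_mono) (auto simp: algebra_simps)
          also have "\<dots> = (C + 1) * \<delta>" using pos by (simp add: M_def)
          finally show ?thesis by (simp add: d \<delta>(2))
        qed
      qed
      moreover have "(SUP z\<in>ball 0 1. (1 - (norm z)\<^sup>2) * norm (deriv (\<lambda>z. ?S z - f z) z)) \<le> \<epsilon> / 2"
        by (rule cSUP_least) (use le in auto)
      moreover have "0 \<le> (SUP z\<in>ball 0 1. (1 - (norm z)\<^sup>2) * norm (deriv (\<lambda>z. ?S z - f z) z))"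
      proof (rule cSUP_upper2[where x = "0::complex"])
        show "bdd_above ((\<lambda>z. (1 - (norm z)\<^sup>2) * norm (deriv (\<lambda>z. ?S z - f z) z)) ` ball 0 1)"
          using le by (intro bdd_aboveI2)
      qed auto
      ultimately show ?thesis
        using \<epsilon> by (simp add: bloch_norm_def)
    qed
    then show "\<exists>n0. \<forall>n\<ge>n0. norm (bloch_norm (\<lambda>z. sigma_mean \<alpha> n f z - f z) - 0) < \<epsilon>" by blast
  qed
qed

section \<open>The pairing on the unit disk\<close>

abbreviation disc :: "real \<Rightarrow> complex measure" where
  "disc r \<equiv> restrict_space lborel (ball 0 r)"

lemma integrable_disc:
  fixes f :: "complex \<Rightarrow> 'a::{banach,second_countable_topology}"
  assumes "continuous_on (cball 0 r) f"
  shows "integrable (disc r) f"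
proof -
  have "set_integrable lborel (cball 0 r) f"
    unfolding set_integrable_def using assms by (intro borel_integrable_compact) auto
  then have "set_integrable lborel (ball 0 r) f"
    by (rule set_integrable_subset) auto
  then show ?thesis by (simp add: integrable_restrict_space set_integrable_def)
qed

lemma integral_disc_eq:
  fixes f :: "complex \<Rightarrow> 'a::{banach,second_countable_topology}"
  shows "(\<integral>z. f z \<partial>disc r) = (LINT z : ball 0 r | lborel. f z)"
  by (simp add: integral_restrict_space set_lebesgue_integral_def)

section \<open>Moments and orthogonality on disks\<close>

lemma measure_disc: "r \<ge> 0 \<Longrightarrow> measure lborel (ball (0::complex) r) = pi * r\<^sup>2"
  by (simp add: content_ball eval_unit_ball_vol)

lemma integral_disc_const: "r \<ge> 0 \<Longrightarrow> (\<integral>z. c \<partial>disc r) = (c::real) * (pi * r\<^sup>2)"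
  by (simp add: measure_restrict_space space_restrict_space measure_disc)

text \<open>The integrand is homogeneous of degree \<open>k\<close>, and the area contributes 2
  more.\<close>

lemma disc_moment_scale:
  assumes "r > 0"
  shows "(\<integral>z. norm z ^ k \<partial>disc r) = r ^ (k + 2) * (\<integral>z. norm z ^ k \<partial>disc 1)"
proof -
  have [measurable]: "(\<lambda>z::complex. indicator (ball 0 r) z * norm z ^ k) \<in> borel_measurable borel"
    by (intro borel_measurable_times borel_measurable_indicator borel_measurable_continuous_onI continuous_intros) auto
  have "(\<integral>z. indicator (ball 0 r) z * norm z ^ k \<partial>(lborel :: complex measure))
      = (\<integral>z. indicator (ball 0 r) z * norm z ^ k \<partial>density (distr lborel borel (\<lambda>z::complex. 0 + r *\<^sub>R z)) (\<lambda>_. ennreal (\<bar>r\<bar> ^ DIM(complex))))"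
    using lborel_affine[of r "0::complex"] assms by simp
  also have "\<dots> = (\<integral>z. r\<^sup>2 *\<^sub>R (indicator (ball 0 r) (r *\<^sub>R z) * norm (r *\<^sub>R z) ^ k) \<partial>(lborel :: complex measure))"
    by (subst integral_density; (subst integral_distr)?) auto
  also have "\<dots> = (\<integral>z. r ^ (k + 2) * (indicator (ball 0 1) z * norm z ^ k) \<partial>(lborel :: complex measure))"
    using assms by (intro Bochner_Integration.integral_cong refl)
      (auto simp: power_mult_distrib power_add mult_ac power2_eq_square split: split_indicator)
  finally show ?thesis
    by (simp add: integral_disc_eq set_lebesgue_integral_def)
qed

text \<open>By scaling, the integral over the annulus \<open>s \<le> \<bar>z\<bar> < 1\<close> is \<open>1 - s ^ (2 * k + 2)\<close> times
  the integral over the unit disk; on the annulus the integrand is almost constant as \<open>s \<rightarrow> 1\<close>.\<close>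
lemma disc_moment_1: "(\<integral>z. norm z ^ (2 * k) \<partial>disc 1) = pi / (real k + 1)"
proof -
  define m where "m = (\<integral>z. norm z ^ (2 * k) \<partial>disc 1)"
  have bounds: "pi * s ^ (2 * k) \<le> m * (\<Sum>i<Suc k. (s\<^sup>2) ^ i) \<and> m * (\<Sum>i<Suc k. (s\<^sup>2) ^ i) \<le> pi"
    if s: "0 < s" "s < 1" for s
  proof -
    let ?I = "\<lambda>f::complex \<Rightarrow> real. \<integral>z. indicator (ball 0 1) z * f z - indicator (ball 0 s) z * f z \<partial>lborel"
    have int: "integrable lborel (\<lambda>z. indicator (ball 0 t) z * f z)"
      if "continuous_on UNIV f" for t and f :: "complex \<Rightarrow> real"
      using integrable_disc[of t f] that
      by (auto simp: integrable_restrict_space intro: continuous_on_subset)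
    have I: "?I f = (\<integral>z. f z \<partial>disc 1) - (\<integral>z. f z \<partial>disc s)" if "continuous_on UNIV f" for f
      using int[OF that] by (simp add: integral_disc_eq set_lebesgue_integral_def)
    have s2: "s\<^sup>2 < 1" using s by (simp add: power_less_one_iff)
    have "?I (\<lambda>z. norm z ^ (2 * k)) = m * (1 - (s\<^sup>2) ^ Suc k)"
    proof -
      have "?I (\<lambda>z. norm z ^ (2 * k)) = m - s ^ (2 * k + 2) * m"
        unfolding m_def disc_moment_scale[OF s(1), symmetric] by (intro I continuous_intros)
      also have "s ^ (2 * k + 2) = (s\<^sup>2) ^ Suc k"
        by (simp add: power_mult power_add power2_eq_square)
      finally show ?thesis by (simp add: algebra_simps)
    qed
    also have "1 - (s\<^sup>2) ^ Suc k = (1 - s\<^sup>2) * (\<Sum>i<Suc k. (s\<^sup>2) ^ i)"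
      by (rule one_diff_power_eq)
    finally have eq: "?I (\<lambda>z. norm z ^ (2 * k)) = (1 - s\<^sup>2) * (m * (\<Sum>i<Suc k. (s\<^sup>2) ^ i))"
      by (simp only: mult_ac)
    have c: "?I (\<lambda>z. c) = (1 - s\<^sup>2) * (pi * c)" for c
    proof -
      have "?I (\<lambda>z. c) = c * (pi * 1\<^sup>2) - c * (pi * s\<^sup>2)"
        using s by (subst I, intro continuous_intros, intro arg_cong2[of _ _ _ _ "(-)"] integral_disc_const) auto
      then show ?thesis by (simp add: algebra_simps)
    qed
    have "?I (\<lambda>z. s ^ (2 * k)) \<le> ?I (\<lambda>z. norm z ^ (2 * k))"
      using s by (intro integral_mono Bochner_Integration.integrable_diff int continuous_intros)
        (auto split: split_indicator intro!: power_mono)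
    then have "(1 - s\<^sup>2) * (pi * s ^ (2 * k)) \<le> (1 - s\<^sup>2) * (m * (\<Sum>i<Suc k. (s\<^sup>2) ^ i))"
      unfolding eq c .
    moreover have "?I (\<lambda>z. norm z ^ (2 * k)) \<le> ?I (\<lambda>z. 1)"
      using s by (intro integral_mono Bochner_Integration.integrable_diff int continuous_intros)
        (auto split: split_indicator intro!: power_le_one)
    then have "(1 - s\<^sup>2) * (m * (\<Sum>i<Suc k. (s\<^sup>2) ^ i)) \<le> (1 - s\<^sup>2) * (pi * 1)"
      unfolding eq c .
    ultimately show ?thesis using s2 by simp
  qed
  \<comment> \<open>The shift by 2 keeps the radius positive already at \<open>n = 0\<close>. As it
    tends to 1, the geometric sum tends to \<open>k + 1\<close> and both bounds meet at
    \<open>pi\<close>.\<close>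
  have s: "0 < 1 - 1 / real (n + 2)" "1 - 1 / real (n + 2) < 1" for n by auto
  have lim: "(\<lambda>n. 1 - 1 / real (n + 2)) \<longlonglongrightarrow> 1" by real_asymp
  have "(\<lambda>n. m * (\<Sum>i<Suc k. ((1 - 1 / real (n + 2))\<^sup>2) ^ i)) \<longlonglongrightarrow> m * (\<Sum>i<Suc k. (1\<^sup>2) ^ i)"
    by (intro tendsto_intros lim)
  then have lim1: "(\<lambda>n. m * (\<Sum>i<Suc k. ((1 - 1 / real (n + 2))\<^sup>2) ^ i)) \<longlonglongrightarrow> m * (real k + 1)"
    by (simp add: add.commute)
  have lim2: "(\<lambda>n. pi * (1 - 1 / real (n + 2)) ^ (2 * k)) \<longlonglongrightarrow> pi * 1 ^ (2 * k)"
    by (intro tendsto_intros lim)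
  have "pi * 1 ^ (2 * k) \<le> m * (real k + 1)"
    using bounds[OF s] by (intro LIMSEQ_le[OF lim2 lim1]) blast
  moreover have "m * (real k + 1) \<le> pi"
    using bounds[OF s] by (intro LIMSEQ_le_const2[OF lim1]) blast
  ultimately have "m = pi / (real k + 1)" by (simp add: field_simps)
  then show ?thesis by (simp only: m_def)
qed

lemma disc_moment:
  assumes "r > 0"
  shows "(\<integral>z. norm z ^ (2 * k) \<partial>disc r) = pi * r ^ (2 * k + 2) / (real k + 1)"
  unfolding disc_moment_scale[OF assms] disc_moment_1 by simp

text \<open>The rotation by the angle \<open>pi / (j - k)\<close> preserves the disk and the radial
  factor but multiplies the integrand by -1, so the integral equals its own negative.\<close>

lemma disc_integral_orthogonal:
  fixes \<rho> :: "real \<Rightarrow> complex"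
  assumes "continuous_on UNIV \<rho>" "j \<noteq> k"
  shows "(\<integral>z. \<rho> (norm z) * z ^ j * cnj z ^ k \<partial>disc r) = 0"
proof -
  define c where "c = cis (pi / (real j - real k))"
  define f where "f z = indicator (ball 0 r) z *\<^sub>R (\<rho> (norm z) * z ^ j * cnj z ^ k)" for z
  have "continuous_on UNIV (\<lambda>z::complex. \<rho> (norm z) * z ^ j * cnj z ^ k)"
    by (intro continuous_intros continuous_on_compose2[OF assms(1)]) auto
  then have f: "f \<in> borel_measurable borel"
    unfolding f_def[abs_def] by (intro borel_measurable_continuous_on_indicator) (auto intro: continuous_on_subset)
  have "c ^ j * cnj c ^ k = cis (real j * (pi / (real j - real k))) * cis (- (real k * (pi / (real j - real k))))"
    by (simp add: c_def Complex.DeMoivre cis_cnj)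
  also have "\<dots> = cis ((real j - real k) * (pi / (real j - real k)))"
    by (simp add: cis_mult left_diff_distrib del: times_divide_eq_right)
  also have "\<dots> = -1" using assms(2) by simp
  finally have c: "c ^ j * cnj c ^ k = -1" .
  have "f (c * z) = - f z" for z
  proof -
    have "f (c * z) = (c ^ j * cnj c ^ k) * f z"
      by (auto simp: f_def c_def norm_mult power_mult_distrib split: split_indicator)
    then show ?thesis by (simp add: c)
  qed
  then have "(\<integral>z. f z \<partial>lborel) = - (\<integral>z. f z \<partial>lborel)"
    using integral_lborel_rotate[OF f, of c] by (simp add: c_def)
  then show ?thesis
    by (simp add: f_def integral_disc_eq set_lebesgue_integral_def)
qed

text \<open>On a disk of radius \<open>r < 1\<close> the terms have the majorant
  \<open>norm (b k) * r ^ k\<close>, which allows termwise integration. The map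
  \<open>\<phi>\<close> will be the identity or the conjugation, so that either factor of the
  pairing can be expanded.\<close>

lemma disc_integral_powser:
  fixes F h :: "complex \<Rightarrow> complex"
  assumes h: "\<And>z. norm z < 1 \<Longrightarrow> (\<lambda>k. b k * z ^ k) sums h z"
    and F: "continuous_on (cball 0 r) F" and r: "0 < r" "r < 1"
    and \<phi>: "continuous_on UNIV \<phi>" "\<And>z. norm (\<phi> z) = norm z"
  shows "(\<lambda>k. b k * (\<integral>z. F z * \<phi> z ^ k \<partial>disc r)) sums (\<integral>z. F z * h (\<phi> z) \<partial>disc r)"
proof -
  define f where "f k z = b k * (F z * \<phi> z ^ k)" for k z
  have \<phi>': "continuous_on A \<phi>" for A using \<phi>(1) by (rule continuous_on_subset) simp
  have int: "integrable (disc r) (f k)" for k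
    unfolding f_def by (intro integrable_disc continuous_intros F \<phi>')
  have intF: "integrable (disc r) (\<lambda>z. norm (F z))"
    by (intro integrable_disc continuous_intros F)
  have sm: "summable (\<lambda>k. norm (b k * of_real r ^ k))"
    using r by (intro powser_summable_norm[OF h]) auto
  have nf: "norm (f k z) = norm (F z) * norm (b k * \<phi> z ^ k)" for k z
    by (simp add: f_def norm_mult)
  have "(\<lambda>k. integral\<^sup>L (disc r) (f k)) sums (\<integral>z. (\<Sum>k. f k z) \<partial>disc r)"
  proof (rule sums_integral[OF int])
    have "summable (\<lambda>k. norm (f k z))" if "z \<in> space (disc r)" for z
      unfolding nf using that r
      by (intro summable_mult powser_summable_norm[OF h]) (auto simp: space_restrict_space \<phi>)
    then show "AE z in disc r. summable (\<lambda>k. norm (f k z))" by (rule AE_I2)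
    have "(\<integral>z. norm (f k z) \<partial>disc r) \<le> (\<integral>z. norm (F z) \<partial>disc r) * norm (b k * of_real r ^ k)" for k
    proof -
      have "(\<integral>z. norm (f k z) \<partial>disc r) \<le> (\<integral>z. norm (F z) * norm (b k * of_real r ^ k) \<partial>disc r)"
      proof (rule integral_mono)
        fix z assume "z \<in> space (disc r)"
        then have "norm z \<le> r" by (simp add: space_restrict_space)
        then have "norm z ^ k \<le> r ^ k" by (intro power_mono) auto
        then show "norm (f k z) \<le> norm (F z) * norm (b k * of_real r ^ k)"
          unfolding nf using r by (intro mult_left_mono) (auto simp: norm_mult norm_power \<phi> intro!: mult_left_mono)
      qed (use int intF in auto)
      then show ?thesis by simp
    qed
    then show "summable (\<lambda>k. \<integral>z. norm (f k z) \<partial>disc r)"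
      by (intro summable_comparison_test'[OF summable_mult[OF sm]]) (auto simp: integral_nonneg)
  qed
  moreover have "(\<integral>z. (\<Sum>k. f k z) \<partial>disc r) = (\<integral>z. F z * h (\<phi> z) \<partial>disc r)"
  proof (rule Bochner_Integration.integral_cong[OF refl])
    fix z assume "z \<in> space (disc r)"
    then have "norm (\<phi> z) < 1" using r by (simp add: space_restrict_space \<phi>)
    from sums_mult[OF h[OF this], of "F z"] show "(\<Sum>k. f k z) = F z * h (\<phi> z)"
      by (simp add: f_def sums_iff mult_ac)
  qed
  moreover have "integral\<^sup>L (disc r) (f k) = b k * (\<integral>z. F z * \<phi> z ^ k \<partial>disc r)" for k
    unfolding f_def by (rule integral_mult_right_zero)
  ultimately show ?thesis by simp
qed

lemma holomorphic_continuous_on_cball: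
  assumes "g holomorphic_on ball 0 1" "r < 1"
  shows "continuous_on (cball 0 r) g"
  using assms by (intro holomorphic_on_imp_continuous_on) (auto intro: holomorphic_on_subset)

text \<open>Expanding \<open>h\<close> leaves integrals of \<open>g\<close> against
  \<open>cnj z ^ k\<close>, and expanding \<open>g\<close> in these leaves the single term
  \<open>j = k\<close>, because the weight is radial. Two successive expansions avoid a double
  series.\<close>

lemma disc_integral_product_sums:
  fixes g h :: "complex \<Rightarrow> complex" and \<rho> :: "real \<Rightarrow> real"
  assumes g: "g holomorphic_on ball 0 1" "\<And>z. norm z < 1 \<Longrightarrow> (\<lambda>k. a k * z ^ k) sums g z"
    and h: "h holomorphic_on ball 0 1" "\<And>z. norm z < 1 \<Longrightarrow> (\<lambda>k. b k * z ^ k) sums h z"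
    and \<rho>: "continuous_on UNIV \<rho>" and r: "0 < r" "r < 1"
  shows "(\<lambda>k. a k * b k * of_real (\<integral>z. \<rho> (norm z) * norm z ^ (2 * k) \<partial>disc r)) sums
     (\<integral>z. of_real (\<rho> (norm z)) * g z * h (cnj z) \<partial>disc r)"
proof -
  define R where "R t = complex_of_real (\<rho> t)" for t
  have R: "continuous_on UNIV R" unfolding R_def by (intro continuous_intros \<rho>)
  have Rn: "continuous_on A (\<lambda>z::complex. R (norm z))" for A
    by (rule continuous_on_compose2[OF R]) (auto intro: continuous_intros)
  note gc = holomorphic_continuous_on_cball[OF g(1) r(2)]
  have J: "(\<integral>z. R (norm z) * g z * cnj z ^ k \<partial>disc r)
      = a k * of_real (\<integral>z. \<rho> (norm z) * norm z ^ (2 * k) \<partial>disc r)" for k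
  proof -
    have "(\<lambda>j. a j * (\<integral>z. (R (norm z) * cnj z ^ k) * z ^ j \<partial>disc r)) sums
        (\<integral>z. (R (norm z) * cnj z ^ k) * g z \<partial>disc r)"
      by (intro disc_integral_powser[OF g(2) _ r, where \<phi> = "\<lambda>z. z"] continuous_intros Rn) auto
    moreover have "(\<lambda>j. a j * (\<integral>z. (R (norm z) * cnj z ^ k) * z ^ j \<partial>disc r)) sums
        (\<Sum>j\<in>{k}. a j * (\<integral>z. (R (norm z) * cnj z ^ k) * z ^ j \<partial>disc r))"
      using disc_integral_orthogonal[OF R] by (intro sums_finite) (auto simp: mult_ac)
    ultimately have "(\<integral>z. (R (norm z) * cnj z ^ k) * g z \<partial>disc r) = a k * (\<integral>z. (R (norm z) * cnj z ^ k) * z ^ k \<partial>disc r)"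
      by (simp add: sums_iff)
    also have "(\<lambda>z. (R (norm z) * cnj z ^ k) * z ^ k) = (\<lambda>z. of_real (\<rho> (norm z) * norm z ^ (2 * k)))"
    proof
      fix z
      have "cnj z ^ k * z ^ k = (z * cnj z) ^ k" by (simp add: power_mult_distrib mult.commute)
      also have "\<dots> = of_real (norm z ^ (2 * k))"
        by (simp add: complex_norm_square[symmetric] power_mult)
      finally show "(R (norm z) * cnj z ^ k) * z ^ k = of_real (\<rho> (norm z) * norm z ^ (2 * k))"
        by (simp add: R_def mult.assoc)
    qed
    finally show ?thesis by (simp add: mult_ac del: of_real_mult)
  qed
  have "(\<lambda>k. b k * (\<integral>z. (R (norm z) * g z) * cnj z ^ k \<partial>disc r)) sums
      (\<integral>z. (R (norm z) * g z) * h (cnj z) \<partial>disc r)"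
    by (intro disc_integral_powser[OF h(2) _ r] continuous_intros Rn gc) auto
  then show ?thesis unfolding J by (simp only: R_def mult_ac)
qed

section \<open>The regularised pairing\<close>

definition pairing_part :: "real \<Rightarrow> (complex \<Rightarrow> complex) \<Rightarrow> (complex \<Rightarrow> complex) \<Rightarrow> complex" where
  "pairing_part r g h = of_real (1 / pi) * (LINT z : ball 0 r | lborel. g z * h (cnj z))"

text \<open>If \<open>h = (\<Sum>k. b k * z ^ k)\<close>, then this is the function with the coefficients \<open>(k + 2) * b k\<close>;
  the factor compensates for the weight \<open>1 - \<bar>z\<bar>\<^sup>2\<close> in the regularised pairing.\<close>
definition pairing_dual :: "(complex \<Rightarrow> complex) \<Rightarrow> complex \<Rightarrow> complex" where
  "pairing_dual h z = 2 * h z + z * deriv h z"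

definition pairing_reg :: "(complex \<Rightarrow> complex) \<Rightarrow> (complex \<Rightarrow> complex) \<Rightarrow> complex" where
  "pairing_reg g h = of_real (1 / pi) *
     (LINT z : ball 0 1 | lborel. of_real (1 - (norm z)\<^sup>2) * g z * pairing_dual h (cnj z))"

lemma pairing_dual_holomorphic:
  "h holomorphic_on ball 0 1 \<Longrightarrow> pairing_dual h holomorphic_on ball 0 1"
  unfolding pairing_dual_def[abs_def] by (intro holomorphic_intros) auto

lemma pairing_dual_sums:
  assumes h: "h holomorphic_on ball 0 1" and z: "norm z < 1"
  shows "(\<lambda>k. of_nat (k + 2) * taylor_coeff h k * z ^ k) sums pairing_dual h z"
proof -
  have h': "deriv h holomorphic_on ball 0 1" using h by (intro holomorphic_deriv) auto
  have "(\<lambda>k. z * (taylor_coeff (deriv h) k * z ^ k)) sums (z * deriv h z)"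
    by (intro sums_mult taylor_coeff_sums h' z)
  then have "(\<lambda>k. of_nat (Suc k) * taylor_coeff h (Suc k) * z ^ Suc k) sums (z * deriv h z)"
    by (simp only: taylor_coeff_deriv power_Suc mult_ac)
  then have "(\<lambda>k. of_nat k * taylor_coeff h k * z ^ k) sums (z * deriv h z)"
    by (subst (asm) sums_Suc_iff) simp
  from sums_add[OF sums_mult[OF taylor_coeff_sums[OF h z], of 2] this]
  show ?thesis by (simp add: pairing_dual_def algebra_simps)
qed

lemma pairing_part_sums:
  assumes "g holomorphic_on ball 0 1" "\<And>z. norm z < 1 \<Longrightarrow> (\<lambda>k. a k * z ^ k) sums g z"
    and "h holomorphic_on ball 0 1" "\<And>z. norm z < 1 \<Longrightarrow> (\<lambda>k. b k * z ^ k) sums h z"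
    and r: "0 < r" "r < 1"
  shows "(\<lambda>k. a k * b k * of_real (r ^ (2 * k + 2) / (real k + 1))) sums pairing_part r g h"
proof -
  have "(\<lambda>k. of_real (1 / pi) * (a k * b k * of_real (\<integral>z. 1 * norm z ^ (2 * k) \<partial>disc r))) sums
      (of_real (1 / pi) * (\<integral>z. of_real 1 * g z * h (cnj z) \<partial>disc r))"
    by (intro sums_mult disc_integral_product_sums assms continuous_intros)
  then have "(\<lambda>k. of_real (1 / pi) * (a k * b k * of_real (pi * r ^ (2 * k + 2) / (real k + 1)))) sums pairing_part r g h"
    unfolding mult_1_left of_real_1 disc_moment[OF r(1)] unfolding pairing_part_def integral_disc_eq .
  then show ?thesis by (simp add: mult.assoc)
qed

text \<open>An integration by parts, checked on coefficients: the weight \<open>r^2 - |z|^2\<close>,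
  which vanishes on the boundary of the smaller disk, has moments with the denominator
  \<open>(k + 1) * (k + 2)\<close>, and the coefficients of \<open>pairing_dual h\<close> cancel
  \<open>k + 2\<close>. Compared with the moments of the unweighted disk, a factor
  \<open>r^2\<close> remains.\<close>

lemma pairing_part_eq_regularised:
  assumes g: "g holomorphic_on ball 0 1" and h: "h holomorphic_on ball 0 1" and r: "0 < r" "r < 1"
  shows "of_real (r\<^sup>2) * pairing_part r g h =
     of_real (1 / pi) * (LINT z : ball 0 r | lborel. of_real (r\<^sup>2 - (norm z)\<^sup>2) * g z * pairing_dual h (cnj z))"
proof -
  let ?a = "taylor_coeff g" and ?b = "taylor_coeff h"
  have m: "(\<integral>z. (r\<^sup>2 - (norm z)\<^sup>2) * norm z ^ (2 * k) \<partial>disc r)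
      = pi * r ^ (2 * k + 4) / ((real k + 1) * (real k + 2))" for k
  proof -
    have "(\<integral>z. (r\<^sup>2 - (norm z)\<^sup>2) * norm z ^ (2 * k) \<partial>disc r)
        = (\<integral>z. r\<^sup>2 * norm z ^ (2 * k) - norm z ^ (2 * Suc k) \<partial>disc r)"
      by (simp add: algebra_simps power_add[symmetric])
    also have "\<dots> = r\<^sup>2 * (\<integral>z. norm z ^ (2 * k) \<partial>disc r) - (\<integral>z. norm z ^ (2 * Suc k) \<partial>disc r)"
      by (subst Bochner_Integration.integral_diff, (intro integrable_disc continuous_intros)+)
        (simp only: integral_mult_right_zero)
    also have "\<dots> = pi * r ^ (2 * k + 4) * (1 / (real k + 1) - 1 / (real k + 2))"
    proof -
      have "r ^ (2 * Suc k + 2) = r ^ (2 * k + 4)" by (simp add: eval_nat_numeral)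
      moreover have "r\<^sup>2 * r ^ (2 * k + 2) = r ^ (2 * k + 4)" by (simp add: eval_nat_numeral mult.assoc)
      ultimately show ?thesis
        unfolding disc_moment[OF r(1)] by (simp add: right_diff_distrib add.commute mult.left_commute)
    qed
    also have "1 / (real k + 1) - 1 / (real k + 2) = 1 / ((real k + 1) * (real k + 2))"
      by (simp add: field_simps)
    finally show ?thesis by simp
  qed
  have "(\<lambda>k. of_real (1 / pi) * (?a k * (of_nat (k + 2) * ?b k) * of_real (\<integral>z. (r\<^sup>2 - (norm z)\<^sup>2) * norm z ^ (2 * k) \<partial>disc r)))
      sums (of_real (1 / pi) * (\<integral>z. of_real (r\<^sup>2 - (norm z)\<^sup>2) * g z * pairing_dual h (cnj z) \<partial>disc r))"
    by (intro sums_mult disc_integral_product_sums g h taylor_coeff_sums pairing_dual_holomorphic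
        pairing_dual_sums r continuous_intros)
  moreover have "of_real (1 / pi) * (?a k * (of_nat (k + 2) * ?b k) * of_real (\<integral>z. (r\<^sup>2 - (norm z)\<^sup>2) * norm z ^ (2 * k) \<partial>disc r))
      = of_real (r\<^sup>2) * (?a k * ?b k * of_real (r ^ (2 * k + 2) / (real k + 1)))" for k
  proof -
    have "(1 / pi) * (real (k + 2) * (pi * r ^ (2 * k + 4) / ((real k + 1) * (real k + 2))))
        = r ^ (2 * k + 4) / (real k + 1)"
    proof -
      have "real k + 2 \<noteq> 0" by linarith
      then show ?thesis by (simp add: add.commute)
    qed
    also have "\<dots> = r\<^sup>2 * (r ^ (2 * k + 2) / (real k + 1))"
      by (simp add: power_add power2_eq_square power4_eq_xxxx)
    finally have "complex_of_real ((1 / pi) * (real (k + 2) * (pi * r ^ (2 * k + 4) / ((real k + 1) * (real k + 2)))))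
        = of_real (r\<^sup>2 * (r ^ (2 * k + 2) / (real k + 1)))" by (rule arg_cong)
    from arg_cong[OF this, of "\<lambda>x. ?a k * ?b k * x"]
    show ?thesis unfolding m by (simp only: of_real_mult of_real_of_nat_eq mult_ac)
  qed
  moreover have "(\<lambda>k. of_real (r\<^sup>2) * (?a k * ?b k * of_real (r ^ (2 * k + 2) / (real k + 1)))) sums
      (of_real (r\<^sup>2) * pairing_part r g h)"
    by (intro sums_mult pairing_part_sums g h taylor_coeff_sums r)
  ultimately show ?thesis
    by (simp only: integral_disc_eq) (rule sums_unique2)
qed

text \<open>On the disk of radius \<open>norm z\<close> the derivative is at most
  \<open>B / w\<close>, so the mean value inequality gives
  \<open>w * norm (h z - h 0) \<le> B\<close>. This is far from the true logarithmic growth but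
  matches the weight. The constant collects \<open>2 * norm (h 0)\<close> and \<open>2 * B\<close>
  from \<open>2 * h z\<close>, and \<open>B\<close> from \<open>z * deriv h z\<close>.\<close>

lemma bloch_pairing_dual_bound:
  assumes "h \<in> bloch_space"
  obtains K where "K \<ge> 0" "\<And>z. norm z < 1 \<Longrightarrow> (1 - (norm z)\<^sup>2) * norm (pairing_dual h z) \<le> K"
proof -
  have hol: "h holomorphic_on ball 0 1" using assms by (simp add: bloch_space_def)
  obtain B where B: "\<And>z. norm z < 1 \<Longrightarrow> (1 - (norm z)\<^sup>2) * norm (deriv h z) \<le> B"
    using assms unfolding bloch_space_def bdd_above_def by fastforce
  have "0 \<le> (1 - (norm (0::complex))\<^sup>2) * norm (deriv h 0)" by simp
  also have "\<dots> \<le> B" by (rule B) simp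
  finally have B0: "B \<ge> 0" .
  show thesis
  proof
    show "0 \<le> 2 * norm (h 0) + 3 * B" using B0 by simp
    fix z :: complex assume z: "norm z < 1"
    define w where "w = 1 - (norm z)\<^sup>2"
    have w: "0 < w" "w \<le> 1" using z by (auto simp: w_def power_less_one_iff abs_square_less_1)
    have "norm (h z - h 0) \<le> (B / w) * norm (z - 0)"
    proof (rule field_differentiable_bound)
      show "convex (cball (0::complex) (norm z))" by simp
      fix u assume u: "u \<in> cball (0::complex) (norm z)"
      then have u1: "norm u < 1" using z by simp
      show "(h has_field_derivative deriv h u) (at u within cball 0 (norm z))"
        by (rule holomorphic_derivI[OF hol]) (use u1 in auto)
      have "(norm u)\<^sup>2 \<le> (norm z)\<^sup>2" using u by (intro power_mono) auto
      then have "w * norm (deriv h u) \<le> (1 - (norm u)\<^sup>2) * norm (deriv h u)"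
        by (intro mult_right_mono) (auto simp: w_def)
      also have "\<dots> \<le> B" by (rule B[OF u1])
      finally show "norm (deriv h u) \<le> B / w" using w by (simp add: pos_le_divide_eq mult.commute)
    qed auto
    also have "\<dots> \<le> (B / w) * 1"
      using z B0 w by (intro mult_left_mono) auto
    finally have "w * norm (h z - h 0) \<le> w * (B / w)"
      using w by (intro mult_left_mono) auto
    then have 1: "w * norm (h z - h 0) \<le> B" using w by simp
    have 2: "w * norm (h 0) \<le> 1 * norm (h 0)" using w by (intro mult_right_mono) auto
    have "norm z * norm (deriv h z) \<le> 1 * norm (deriv h z)" using z by (intro mult_right_mono) auto
    then have 3: "w * (norm z * norm (deriv h z)) \<le> w * norm (deriv h z)"
      using w by (intro mult_left_mono) auto
    have "norm (pairing_dual h z) \<le> norm (2 * h z) + norm (z * deriv h z)"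
      unfolding pairing_dual_def by (rule norm_triangle_ineq)
    also have "\<dots> \<le> 2 * (norm (h z - h 0) + norm (h 0)) + norm z * norm (deriv h z)"
      using norm_triangle_ineq[of "h z - h 0" "h 0"] by (simp add: norm_mult)
    finally have "w * norm (pairing_dual h z) \<le> w * (2 * (norm (h z - h 0) + norm (h 0)) + norm z * norm (deriv h z))"
      using w by (intro mult_left_mono) auto
    also have "\<dots> = 2 * (w * norm (h z - h 0)) + 2 * (w * norm (h 0)) + w * (norm z * norm (deriv h z))"
      by (simp add: algebra_simps)
    also have "\<dots> \<le> 2 * B + 2 * norm (h 0) + B"
      using 1 2 3 B[OF z] by (simp add: w_def)
    finally show "(1 - (norm z)\<^sup>2) * norm (pairing_dual h z) \<le> 2 * norm (h 0) + 3 * B"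
      by (simp add: w_def)
  qed
qed

context
  fixes h :: "complex \<Rightarrow> complex" and K :: real
  assumes h: "h holomorphic_on ball 0 1" and K: "K \<ge> 0"
    "\<And>z. norm z < 1 \<Longrightarrow> (1 - (norm z)\<^sup>2) * norm (pairing_dual h z) \<le> K"
begin

lemma pairing_integrand_measurable:
  assumes "g holomorphic_on ball 0 1" "s \<le> 1" "continuous_on UNIV \<rho>"
  shows "(\<lambda>z. indicator (ball 0 s) z *\<^sub>R (of_real (\<rho> (norm z)) * g z * pairing_dual h (cnj z)))
    \<in> borel_measurable borel"
proof (rule borel_measurable_continuous_on_indicator)
  have "continuous_on (ball 0 1) g" "continuous_on (ball 0 1) (pairing_dual h)"
    by (intro holomorphic_on_imp_continuous_on pairing_dual_holomorphic h assms)+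
  moreover have "continuous_on (ball 0 s) (\<lambda>z::complex. \<rho> (norm z))"
    by (rule continuous_on_compose2[OF assms(3)]) (auto intro: continuous_intros)
  ultimately show "continuous_on (ball 0 s) (\<lambda>z. of_real (\<rho> (norm z)) * g z * pairing_dual h (cnj z))"
    using assms(2)
    by (intro continuous_intros continuous_on_compose2[of "ball 0 1" "pairing_dual h" _ cnj])
      (auto intro: continuous_on_subset)
qed simp

text \<open>The weight is an arbitrary number below \<open>1 - |z|^2\<close>, so that the truncated
  weights \<open>r^2 - |z|^2\<close> and the limiting one share the same majorant.\<close>

lemma pairing_integrand_bound:
  assumes "norm z < 1" "0 \<le> \<rho>" "\<rho> \<le> 1 - (norm z)\<^sup>2"
  shows "norm (of_real \<rho> * g z * pairing_dual h (cnj z)) \<le> K * norm (g z)"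
proof -
  have "\<rho> * norm (pairing_dual h (cnj z)) \<le> (1 - (norm (cnj z))\<^sup>2) * norm (pairing_dual h (cnj z))"
    using assms by (intro mult_right_mono) auto
  also have "\<dots> \<le> K" using assms by (intro K) auto
  finally have "(\<rho> * norm (pairing_dual h (cnj z))) * norm (g z) \<le> K * norm (g z)"
    by (intro mult_right_mono) auto
  then show ?thesis using assms by (simp add: norm_mult mult_ac)
qed

lemma pairing_reg_integrable:
  assumes g: "g \<in> bergman_A1"
  shows "set_integrable lborel (ball 0 1) (\<lambda>z. of_real (1 - (norm z)\<^sup>2) * g z * pairing_dual h (cnj z))"
  unfolding set_integrable_def
proof (rule Bochner_Integration.integrable_bound)
  show "integrable lborel (\<lambda>z. K * (indicator (ball 0 1) z * norm (g z)))"
    using g by (intro integrable_mult_right) (simp add: bergman_A1_def set_integrable_def)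
  show "(\<lambda>z. indicator (ball 0 1) z *\<^sub>R (of_real (1 - (norm z)\<^sup>2) * g z * pairing_dual h (cnj z))) \<in> borel_measurable lborel"
  proof -
    have "g holomorphic_on ball 0 1" "continuous_on UNIV (\<lambda>t::real. 1 - t\<^sup>2)"
      using g by (auto simp: bergman_A1_def intro!: continuous_intros)
    from pairing_integrand_measurable[OF this(1) order_refl this(2)] show ?thesis by simp
  qed
  show "AE z in lborel. norm (indicator (ball 0 1) z *\<^sub>R (of_real (1 - (norm z)\<^sup>2) * g z * pairing_dual h (cnj z)))
      \<le> norm (K * (indicator (ball 0 1) z * norm (g z)))"
  proof (rule AE_I2)
    fix z
    show "norm (indicator (ball 0 1) z *\<^sub>R (of_real (1 - (norm z)\<^sup>2) * g z * pairing_dual h (cnj z)))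
      \<le> norm (K * (indicator (ball 0 1) z * norm (g z)))"
    proof (cases "norm z < 1")
      case True
      then have "0 \<le> 1 - (norm z)\<^sup>2" by (simp add: power_le_one)
      from pairing_integrand_bound[OF True this order_refl, of g] show ?thesis
        using True K(1) by (simp add: abs_mult)
    qed simp
  qed
qed

text \<open>The regularised form of the truncated pairing has the integrable majorant
  \<open>K * norm (g z)\<close>, and the factor \<open>r^2\<close> by which it differs tends to 1.
  Dominated convergence is applied along an arbitrary sequence of radii.\<close>

lemma pairing_part_tendsto:
  assumes g: "g \<in> bergman_A1"
  shows "((\<lambda>r. pairing_part r g h) \<longlongrightarrow> pairing_reg g h) (at_left 1)"
proof (rule tendsto_at_left_sequentially[of 0])
  fix S :: "nat \<Rightarrow> real"
  assume S: "\<And>n. S n < 1" "\<And>n. 0 < S n" "S \<longlonglongrightarrow> 1"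
  have hol: "g holomorphic_on ball 0 1" using g by (simp add: bergman_A1_def)
  let ?f = "\<lambda>n z. indicator (ball 0 (S n)) z *\<^sub>R (of_real ((S n)\<^sup>2 - (norm z)\<^sup>2) * g z * pairing_dual h (cnj z))"
  let ?f' = "\<lambda>z. indicator (ball 0 1) z *\<^sub>R (of_real (1 - (norm z)\<^sup>2) * g z * pairing_dual h (cnj z))"
  have lim: "(\<lambda>n. \<integral>z. ?f n z \<partial>lborel) \<longlonglongrightarrow> (\<integral>z. ?f' z \<partial>lborel)"
  proof (rule integral_dominated_convergence)
    show "integrable lborel (\<lambda>z. K * (indicator (ball 0 1) z * norm (g z)))"
      using g by (intro integrable_mult_right) (simp add: bergman_A1_def set_integrable_def)
    show "?f' \<in> borel_measurable lborel"
    proof -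
      have "continuous_on UNIV (\<lambda>t::real. 1 - t\<^sup>2)" by (intro continuous_intros)
      from pairing_integrand_measurable[OF hol order_refl this] show ?thesis by simp
    qed
    show "?f n \<in> borel_measurable lborel" for n
    proof -
      have "continuous_on UNIV (\<lambda>t. (S n)\<^sup>2 - t\<^sup>2)" by (intro continuous_intros)
      from pairing_integrand_measurable[OF hol less_imp_le[OF S(1)] this] show ?thesis by simp
    qed
    show "AE z in lborel. norm (?f n z) \<le> K * (indicator (ball 0 1) z * norm (g z))" for n
    proof (rule AE_I2)
      fix z
      show "norm (?f n z) \<le> K * (indicator (ball 0 1) z * norm (g z))"
      proof (cases "norm z < S n")
        case True
        then have "norm z < 1" using S(1)[of n] by linarith
        moreover have "0 \<le> (S n)\<^sup>2 - (norm z)\<^sup>2" using True by (simp add: power_mono)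
        moreover have "(S n)\<^sup>2 - (norm z)\<^sup>2 \<le> 1 - (norm z)\<^sup>2"
          using S(1,2)[of n] by (simp add: power_le_one less_imp_le)
        ultimately show ?thesis
          using pairing_integrand_bound[of z "(S n)\<^sup>2 - (norm z)\<^sup>2" g] True by simp
      qed (use K in \<open>auto simp: indicator_def\<close>)
    qed
    show "AE z in lborel. (\<lambda>n. ?f n z) \<longlonglongrightarrow> ?f' z"
    proof (rule AE_I2)
      fix z :: complex
      show "(\<lambda>n. ?f n z) \<longlonglongrightarrow> ?f' z"
      proof (cases "norm z < 1")
        case True
        have "(\<lambda>n. of_real ((S n)\<^sup>2 - (norm z)\<^sup>2) * g z * pairing_dual h (cnj z)) \<longlonglongrightarrow>
            of_real (1\<^sup>2 - (norm z)\<^sup>2) * g z * pairing_dual h (cnj z)"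
          by (intro tendsto_intros S(3))
        moreover have "eventually (\<lambda>n. of_real ((S n)\<^sup>2 - (norm z)\<^sup>2) * g z * pairing_dual h (cnj z) = ?f n z) sequentially"
          using order_tendstoD(1)[OF S(3) True] by eventually_elim simp
        ultimately show ?thesis using True by (simp add: tendsto_cong)
      next
        case False
        then have "\<not> norm z < S n" for n using S(1)[of n] by linarith
        then show ?thesis using False by simp
      qed
    qed
  qed
  have "(\<lambda>n. (of_real (1 / pi) * (\<integral>z. ?f n z \<partial>lborel)) / of_real ((S n)\<^sup>2)) \<longlonglongrightarrow>
      (of_real (1 / pi) * (\<integral>z. ?f' z \<partial>lborel)) / of_real (1\<^sup>2)"
    by (intro tendsto_intros lim S(3)) auto
  moreover have "(of_real (1 / pi) * (\<integral>z. ?f n z \<partial>lborel)) / of_real ((S n)\<^sup>2) = pairing_part (S n) g h" for n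
    using pairing_part_eq_regularised[OF hol h S(2,1), of n] S(2)[of n]
    by (simp add: set_lebesgue_integral_def field_simps)
  ultimately show "(\<lambda>n. pairing_part (S n) g h) \<longlonglongrightarrow> pairing_reg g h"
    by (simp add: pairing_reg_def set_lebesgue_integral_def)
qed simp

lemma pairing_reg_diff_bound:
  assumes f: "f \<in> bergman_A1" and g: "g \<in> bergman_A1"
  shows "norm (pairing_reg f h - pairing_reg g h) \<le> K * bergman_norm (\<lambda>z. f z - g z)"
proof -
  let ?d = "\<lambda>z. of_real (1 - (norm z)\<^sup>2) * (f z - g z) * pairing_dual h (cnj z)"
  have hol: "f holomorphic_on ball 0 1" "g holomorphic_on ball 0 1"
    using f g by (simp_all add: bergman_A1_def)
  have eq: "pairing_reg f h - pairing_reg g h = of_real (1 / pi) * (LINT z : ball 0 1 | lborel. ?d z)"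
    unfolding pairing_reg_def right_diff_distrib[symmetric]
      set_integral_diff(2)[OF pairing_reg_integrable[OF f] pairing_reg_integrable[OF g], symmetric]
    by (simp only: left_diff_distrib right_diff_distrib)
  have "integrable lborel (\<lambda>z. indicator (ball 0 1) z * norm (f z - g z))"
  proof (rule Bochner_Integration.integrable_bound)
    show "integrable lborel (\<lambda>z. indicator (ball 0 1) z * norm (f z) + indicator (ball 0 1) z * norm (g z))"
      using f g by (intro Bochner_Integration.integrable_add) (simp_all add: bergman_A1_def set_integrable_def)
    have "(\<lambda>z. indicator (ball 0 1) z *\<^sub>R (f z - g z)) \<in> borel_measurable borel"
      by (intro borel_measurable_continuous_on_indicator holomorphic_on_imp_continuous_on holomorphic_intros hol) simp
    then have "(\<lambda>z. indicator (ball 0 1) z *\<^sub>R (f z - g z)) \<in> borel_measurable lborel" by simp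
    from measurable_compose[OF this borel_measurable_norm]
    show "(\<lambda>z. indicator (ball 0 1) z * norm (f z - g z)) \<in> borel_measurable lborel"
      by (simp only: norm_scaleR abs_of_nonneg[OF indicator_pos_le])
    show "AE z in lborel. norm (indicator (ball 0 1) z * norm (f z - g z))
        \<le> norm (indicator (ball 0 1) z * norm (f z) + indicator (ball 0 1) z * norm (g z))"
      by (rule AE_I2) (auto split: split_indicator intro: norm_triangle_ineq4)
  qed
  then have int: "integrable lborel (\<lambda>z. K * (indicator (ball 0 1) z * norm (f z - g z)))"
    by (rule integrable_mult_right)
  have "norm (LINT z : ball 0 1 | lborel. ?d z) \<le> (\<integral>z. norm (indicator (ball 0 1) z *\<^sub>R ?d z) \<partial>lborel)"
    unfolding set_lebesgue_integral_def by (rule integral_norm_bound)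
  also have "\<dots> \<le> (\<integral>z. K * (indicator (ball 0 1) z * norm (f z - g z)) \<partial>lborel)"
  proof (rule integral_mono)
    show "integrable lborel (\<lambda>z. norm (indicator (ball 0 1) z *\<^sub>R ?d z))"
      using integrable_norm[OF set_integral_diff(1)[OF pairing_reg_integrable[OF f] pairing_reg_integrable[OF g], unfolded set_integrable_def]]
      by (simp only: left_diff_distrib right_diff_distrib)
    show "norm (indicator (ball 0 1) z *\<^sub>R ?d z) \<le> K * (indicator (ball 0 1) z * norm (f z - g z))" for z
    proof (cases "norm z < 1")
      case True
      then have "0 \<le> 1 - (norm z)\<^sup>2" by (simp add: power_le_one)
      from pairing_integrand_bound[OF True this order_refl, of "\<lambda>z. f z - g z"] show ?thesis
        using True by simp
    qed simp
  qed (rule int)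
  also have "\<dots> = K * (LINT z : ball 0 1 | lborel. norm (f z - g z))"
    by (simp add: set_lebesgue_integral_def)
  finally have "(1 / pi) * norm (LINT z : ball 0 1 | lborel. ?d z) \<le> (1 / pi) * (K * (LINT z : ball 0 1 | lborel. norm (f z - g z)))"
    by (intro mult_left_mono) auto
  then show ?thesis
    unfolding eq norm_mult norm_of_real by (simp add: bergman_norm_def mult_ac)
qed

end

text \<open>Since \<open>bergman_pairing\<close> is a \<open>Lim\<close>, its value is meaningful
  only after a limit has been exhibited.\<close>

lemma bergman_pairing_eqI:
  assumes "((\<lambda>r. pairing_part r g h) \<longlongrightarrow> L) (at_left 1)"
  shows "bergman_pairing g h = L"
  using assms unfolding bergman_pairing_def pairing_part_def by (intro tendsto_Lim) auto

lemma sigma_mean_bergman_A1: "sigma_mean \<alpha> n g \<in> bergman_A1"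
proof -
  have "continuous_on (cball 0 1) (\<lambda>z. norm (sigma_mean \<alpha> n g z))"
    by (intro continuous_intros holomorphic_on_imp_continuous_on sigma_mean_holomorphic)
  then have "set_integrable lborel (cball 0 1) (\<lambda>z. norm (sigma_mean \<alpha> n g z))"
    unfolding set_integrable_def by (intro borel_integrable_compact) auto
  then have "set_integrable lborel (ball 0 1) (\<lambda>z. norm (sigma_mean \<alpha> n g z))"
    by (rule set_integrable_subset) auto
  then show ?thesis by (simp add: bergman_A1_def sigma_mean_holomorphic)
qed

text \<open>The truncated pairing depends only on the products of coefficients with equal index, so
  the weights may be attached to either factor.\<close>

lemma pairing_part_sigma_mean_swap:
  assumes g: "g holomorphic_on ball 0 1" and h: "h holomorphic_on ball 0 1" and r: "0 < r" "r < 1"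
  shows "pairing_part r g (sigma_mean \<alpha> n h) = pairing_part r (sigma_mean \<alpha> n g) h"
proof -
  let ?W = "\<lambda>k. complex_of_real (cesaro_weight \<alpha> n k)"
  have "(\<lambda>k. taylor_coeff g k * (?W k * taylor_coeff h k) * of_real (r ^ (2 * k + 2) / (real k + 1)))
      sums pairing_part r g (sigma_mean \<alpha> n h)"
    by (intro pairing_part_sums g taylor_coeff_sums sigma_mean_holomorphic sigma_mean_sums r)
  moreover have "(\<lambda>k. (?W k * taylor_coeff g k) * taylor_coeff h k * of_real (r ^ (2 * k + 2) / (real k + 1)))
      sums pairing_part r (sigma_mean \<alpha> n g) h"
    by (intro pairing_part_sums h taylor_coeff_sums sigma_mean_holomorphic sigma_mean_sums r)
  ultimately show ?thesis
    by (simp only: mult_ac sums_iff)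
qed

lemma bergman_pairing_sigma_mean_tendsto:
  assumes \<alpha>: "\<alpha> > 0" and h: "h \<in> bloch_space" and g: "g \<in> bergman_A1"
  shows "(\<lambda>n. bergman_pairing g (sigma_mean \<alpha> n h)) \<longlonglongrightarrow> bergman_pairing g h"
proof -
  have hol: "g holomorphic_on ball 0 1" "h holomorphic_on ball 0 1"
    using g h by (simp_all add: bergman_A1_def bloch_space_def)
  obtain K where K: "K \<ge> 0" "\<And>z. norm z < 1 \<Longrightarrow> (1 - (norm z)\<^sup>2) * norm (pairing_dual h z) \<le> K"
    using bloch_pairing_dual_bound[OF h] by blast
  have 1: "bergman_pairing g h = pairing_reg g h"
    by (intro bergman_pairing_eqI pairing_part_tendsto[OF hol(2) K] g)
  \<comment> \<open>The truncated pairings agree for \<open>0 < r < 1\<close>, which is all that a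
    left limit at 1 sees. The limit for the polynomial acting as \<open>g\<close> therefore yields
    both the existence and the value of the limit wanted here.\<close>
  have 2: "bergman_pairing g (sigma_mean \<alpha> n h) = pairing_reg (sigma_mean \<alpha> n g) h" for n
  proof (rule bergman_pairing_eqI)
    have "eventually (\<lambda>r::real. r \<in> {0<..<1}) (at_left 1)"
      by (rule eventually_at_leftI[of 0]) auto
    then have "eventually (\<lambda>r. pairing_part r (sigma_mean \<alpha> n g) h = pairing_part r g (sigma_mean \<alpha> n h)) (at_left 1)"
      by eventually_elim (simp add: pairing_part_sigma_mean_swap[OF hol])
    then show "((\<lambda>r. pairing_part r g (sigma_mean \<alpha> n h)) \<longlongrightarrow> pairing_reg (sigma_mean \<alpha> n g) h) (at_left 1)"
      using pairing_part_tendsto[OF hol(2) K sigma_mean_bergman_A1] by (rule Lim_transform_eventually[rotated])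
  qed
  have "(\<lambda>n. pairing_reg (sigma_mean \<alpha> n g) h - pairing_reg g h) \<longlonglongrightarrow> 0"
  proof (rule Lim_null_comparison)
    show "eventually (\<lambda>n. norm (pairing_reg (sigma_mean \<alpha> n g) h - pairing_reg g h)
        \<le> K * bergman_norm (\<lambda>z. sigma_mean \<alpha> n g z - g z)) sequentially"
      by (intro always_eventually allI pairing_reg_diff_bound[OF hol(2) K] sigma_mean_bergman_A1 g)
    show "(\<lambda>n. K * bergman_norm (\<lambda>z. sigma_mean \<alpha> n g z - g z)) \<longlonglongrightarrow> 0"
      by (rule tendsto_mult_right_zero[OF bergman_norm_sigma_mean_tendsto_0[OF \<alpha> g]])
  qed
  then show ?thesis unfolding 1 2 by (simp add: LIM_zero_iff)
qed

theorem theorem5p8: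
  fixes \<alpha> :: real
  assumes "\<alpha> > 0"
  shows "(\<forall>g \<in> bergman_A1.
            (\<lambda>n. bergman_norm (\<lambda>z. sigma_mean \<alpha> n g z - g z)) \<longlonglongrightarrow> 0)
       \<and> (\<forall>h \<in> bloch_space. \<forall>g \<in> bergman_A1.
            (\<lambda>n. bergman_pairing g (sigma_mean \<alpha> n h)) \<longlonglongrightarrow> bergman_pairing g h)
       \<and> (\<forall>f \<in> little_bloch.
            (\<lambda>n. bloch_norm (\<lambda>z. sigma_mean \<alpha> n f z - f z)) \<longlonglongrightarrow> 0)"
  using bergman_norm_sigma_mean_tendsto_0[OF assms] bergman_pairing_sigma_mean_tendsto[OF assms]
    bloch_norm_sigma_mean_tendsto_0[OF assms]
  by blast

end
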